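(* Let $\mathbb{C}>0$, $\sigma_0\ge0$ and $\bar\epsilon\in\mathbb{R}$ be constants. Let $Z=L^2(0,1)\times L^2(0,1)$ and $$\mathcal{E}=\Big\{(\epsilon,\sigma)\in Z:\ \int_0^1\epsilon\,dx=\bar\epsilon,\ \sigma \text{ is (a.e. equal to) a constant } \bar\sigma\in\mathbb{R}\Big\}.$$ Let $$\mathcal{D}_{\rm loc}=\{(\epsilon,\mathbb{C}\epsilon+\sigma_0):\epsilon\le0\}\cup\{(\epsilon,\mathbb{C}\epsilon-\sigma_0):\epsilon\ge0\}\subset\mathbb{R}^2,$$ $$\begin{aligned}\bar{\mathcal{D}}_{\rm loc}=&\ \{(\epsilon,\mathbb{C}\epsilon+\sigma_0):\epsilon\le-2\sigma_0/\mathbb{C}\}\\&\cup\{(\epsilon,\sigma):-2\sigma_0/\mathbb{C}\le\epsilon\le0,\ \sigma\in[-\sigma_0,\mathbb{C}\epsilon+\sigma_0]\}\\&\cup\{(\epsilon,\sigma):0\le\epsilon\le2\sigma_0/\mathbb{C},\ \sigma\in[\mathbb{C}\epsilon-\sigma_0,\sigma_0]\}\\&\cup\{(\epsilon,\mathbb{C}\epsilon-\sigma_0):\epsilon\ge2\sigma_0/\mathbb{C}\},\end{aligned}$$ and let $\mathcal{D}=\{y\in Z:\ y(x)\in\mathcal{D}_{\rm loc}\text{ for a.e. }x\in(0,1)\}$ and $\bar{\mathcal{D}}=\{y\in Z:\ y(x)\in\bar{\mathcal{D}}_{\rm loc}\text{ for a.e. }x\in(0,1)\}$. Then $\bar{\mathcal{D}}\times\mathcal{E}=K(\Delta)\text{-}\lim_{h\to\infty}(\mathcal{D}\times\mathcal{E})$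 (limit of the constant sequence).
   Context: $I_A$ is the indicator function of a set $A$: $0$ on $A$ and $\infty$ elsewhere. Data topology $\Delta$ on $Z\times Z$: the coarsest topology for which all sets $(A\times A')\cap\{(z,z'):z-z'\in C\}$ are open, with $A,A'\subset Z$ weakly open and $C\subset Z$ strongly open. A sequence $(y_h,z_h)$ is said to converge to $(y,z)$ in this sense if $y_h\rightharpoonup y$, $z_h\rightharpoonup z$ weakly and $y_h-z_h\to y-z$ strongly. Kuratowski limit: for subsets $S,S_h$ of $Z\times Z$, $S=K(\Delta)\text{-}\lim_{h\to\infty}S_h$ means that the indicator functions $I_{S_h}$ $\Gamma$-converge to $I_S$ with respect to $\Delta$, i.e. for all $p\in Z\times Z$ $$I_S(p)=\sup_{U\in\mathcal{N}(p)}\liminf_{h\to\infty}\inf_{q\in U}I_{S_h}(q)=\sup_{U\in\mathcal{N}(p)}\limsup_{h\to\infty}\inf_{q\in U}I_{S_h}(q),$$ where $\mathcal{N}(p)$ is the family of all $\Delta$-open sets containing $p$. *)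

theory Defs
  imports "HOL-Analysis.Analysis"
begin

abbreviation unit_leb :: "real measure"
  where "unit_leb \<equiv> lebesgue_on {0<..<1}"

definition sq_integrable :: "(real \<Rightarrow> real) \<Rightarrow> bool"
  where "sq_integrable f \<longleftrightarrow>
    f \<in> borel_measurable unit_leb \<and> integrable unit_leb (\<lambda>x. (f x)\<^sup>2)"

lemma sq_integrable_mult:
  assumes "sq_integrable f" "sq_integrable g"
  shows "integrable unit_leb (\<lambda>x. f x * g x)"
proof (rule Bochner_Integration.integrable_bound)
  show "integrable unit_leb (\<lambda>x. (f x)\<^sup>2 + (g x)\<^sup>2)"
    using assms by (simp add: sq_integrable_def)
  show "(\<lambda>x. f x * g x) \<in> borel_measurable unit_leb"
    using assms by (auto simp: sq_integrable_def intro: borel_measurable_times)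
  have "\<bar>a * b\<bar> \<le> a\<^sup>2 + b\<^sup>2" for a b :: real
    using sum_squares_bound[of "\<bar>a\<bar>" "\<bar>b\<bar>"] zero_le_power2[of a] zero_le_power2[of b]
    unfolding abs_mult power2_abs by linarith
  then show "AE x in unit_leb. norm (f x * g x) \<le> norm ((f x)\<^sup>2 + (g x)\<^sup>2)"
    by simp
qed

lemma sq_integrable_0: "sq_integrable (\<lambda>x. 0)"
  by (simp add: sq_integrable_def)

lemma sq_integrable_add:
  assumes "sq_integrable f" "sq_integrable g"
  shows "sq_integrable (\<lambda>x. f x + g x)"
proof -
  have "(f x + g x)\<^sup>2 = (f x)\<^sup>2 + (g x)\<^sup>2 + 2 * (f x * g x)" for x
    by (simp add: power2_sum)
  then show ?thesis
    using assms sq_integrable_mult[OF assms]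
    by (auto simp: sq_integrable_def intro: borel_measurable_add)
qed

lemma sq_integrable_scale:
  assumes "sq_integrable f"
  shows "sq_integrable (\<lambda>x. c * f x)"
  using assms by (auto simp: sq_integrable_def power_mult_distrib intro: borel_measurable_times)

definition L2_rel :: "(real \<Rightarrow> real) \<Rightarrow> (real \<Rightarrow> real) \<Rightarrow> bool"
  where "L2_rel f g \<longleftrightarrow>
    sq_integrable f \<and> sq_integrable g \<and> (AE x in unit_leb. f x = g x)"

lemma part_equivp_L2_rel: "part_equivp L2_rel"
proof (rule part_equivpI)
  show "\<exists>f. L2_rel f f"
    using sq_integrable_0 by (auto simp: L2_rel_def)
  show "symp L2_rel"
    by (auto simp: symp_def L2_rel_def elim: eventually_mono)
  show "transp L2_rel"
    unfolding transp_def L2_rel_def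
    by (auto elim: eventually_elim2)
qed

quotient_type L2 = "real \<Rightarrow> real" / partial: L2_rel
  by (rule part_equivp_L2_rel)

instantiation L2 :: real_vector
begin

lift_definition zero_L2 :: L2 is "\<lambda>x. 0"
  by (simp add: L2_rel_def sq_integrable_0)

lift_definition plus_L2 :: "L2 \<Rightarrow> L2 \<Rightarrow> L2" is "\<lambda>f g x. f x + g x"
  unfolding L2_rel_def by (auto intro: sq_integrable_add elim: eventually_elim2)

lift_definition scaleR_L2 :: "real \<Rightarrow> L2 \<Rightarrow> L2" is "\<lambda>c f x. c * f x"
  unfolding L2_rel_def by (auto intro: sq_integrable_scale elim: eventually_mono)

definition uminus_L2 :: "L2 \<Rightarrow> L2"
  where "uminus_L2 f = (- 1) *\<^sub>R f"

definition minus_L2 :: "L2 \<Rightarrow> L2 \<Rightarrow> L2"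
  where "minus_L2 f g = f + (- g)"

instance
proof
  fix f g h :: L2 and a b :: real
  show "f + g + h = f + (g + h)"
    by transfer (simp add: L2_rel_def sq_integrable_add add.assoc)
  show "f + g = g + f"
    by transfer (simp add: L2_rel_def sq_integrable_add add.commute)
  show "0 + f = f"
    by transfer (simp add: L2_rel_def)
  show "- f + f = 0"
    unfolding uminus_L2_def by transfer (simp add: L2_rel_def sq_integrable_0)
  show "f - g = f + - g"
    by (simp add: minus_L2_def)
  show "a *\<^sub>R (f + g) = a *\<^sub>R f + a *\<^sub>R g"
    by transfer (simp add: L2_rel_def sq_integrable_add sq_integrable_scale distrib_left)
  show "(a + b) *\<^sub>R f = a *\<^sub>R f + b *\<^sub>R f"
    by transfer (simp add: L2_rel_def sq_integrable_add sq_integrable_scale distrib_right)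
  show "a *\<^sub>R b *\<^sub>R f = (a * b) *\<^sub>R f"
    by transfer (simp add: L2_rel_def sq_integrable_scale mult.assoc)
  show "1 *\<^sub>R f = f"
    by transfer (simp add: L2_rel_def)
qed

end

instantiation L2 :: real_inner
begin

lift_definition inner_L2 :: "L2 \<Rightarrow> L2 \<Rightarrow> real"
  is "\<lambda>f g. \<integral>x. f x * g x \<partial>unit_leb"
proof -
  fix f f' g g'
  assume *: "L2_rel f f'" "L2_rel g g'"
  show "(\<integral>x. f x * g x \<partial>unit_leb) = (\<integral>x. f' x * g' x \<partial>unit_leb)"
  proof (rule integral_cong_AE)
    show "AE x in unit_leb. f x * g x = f' x * g' x"
      using * unfolding L2_rel_def by (auto elim: eventually_elim2)
  qed (use * in \<open>auto simp: L2_rel_def sq_integrable_def intro: borel_measurable_times\<close>)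
qed

definition norm_L2 :: "L2 \<Rightarrow> real"
  where "norm_L2 f = sqrt (inner f f)"

definition sgn_L2 :: "L2 \<Rightarrow> L2"
  where "sgn_L2 f = f /\<^sub>R norm f"

definition dist_L2 :: "L2 \<Rightarrow> L2 \<Rightarrow> real"
  where "dist_L2 f g = norm (f - g)"

definition uniformity_L2 :: "(L2 \<times> L2) filter"
  where "uniformity_L2 = (INF e\<in>{0<..}. principal {(f, g). dist f g < e})"

definition open_L2 :: "L2 set \<Rightarrow> bool"
  where "open_L2 U \<longleftrightarrow> (\<forall>x\<in>U. eventually (\<lambda>(x', y). x' = x \<longrightarrow> y \<in> U) uniformity)"

instance
proof
  fix f g h :: L2 and a :: real
  show "inner f g = inner g f"
    by transfer (simp add: mult.commute)
  show "inner (f + g) h = inner f h + inner g h"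
    by transfer (simp add: L2_rel_def distrib_right sq_integrable_mult)
  show "inner (a *\<^sub>R f) g = a * inner f g"
    by transfer (simp add: mult.assoc)
  show "0 \<le> inner f f"
    by transfer simp
  show "inner f f = 0 \<longleftrightarrow> f = 0"
  proof transfer
    fix f assume "L2_rel f f"
    then have f: "sq_integrable f"
      by (simp add: L2_rel_def)
    have "(\<integral>x. f x * f x \<partial>unit_leb) = 0 \<longleftrightarrow> (AE x in unit_leb. f x * f x = 0)"
      by (rule integral_nonneg_eq_0_iff_AE) (use sq_integrable_mult[OF f f] in auto)
    then show "((\<integral>x. f x * f x \<partial>unit_leb) = 0) = L2_rel f (\<lambda>x. 0)"
      using f sq_integrable_0 by (simp add: L2_rel_def)
  qed
qed (fact norm_L2_def sgn_L2_def dist_L2_def uniformity_L2_def open_L2_def)+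

end

text \<open>An arbitrary square-integrable representative of a class; everything below depends on it
  only up to null sets.\<close>

definition L2_fun :: "L2 \<Rightarrow> real \<Rightarrow> real"
  where "L2_fun = rep_L2"

lemma sq_integrable_L2_fun: "sq_integrable (L2_fun f)"
  using Quotient3_rep_reflp[OF Quotient3_L2, of f] by (simp add: L2_fun_def L2_rel_def)

lemma abs_L2_L2_fun: "abs_L2 (L2_fun f) = f"
  unfolding L2_fun_def by (rule Quotient3_abs_rep[OF Quotient3_L2])

lemma AE_L2_fun_abs_L2:
  assumes "sq_integrable f"
  shows "AE x in unit_leb. L2_fun (abs_L2 f) x = f x"
proof -
  have "L2_rel (rep_L2 (abs_L2 f)) f"
    by (rule Quotient3_rep_abs[OF Quotient3_L2]) (use assms in \<open>simp add: L2_rel_def\<close>)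
  then show ?thesis
    by (simp add: L2_fun_def L2_rel_def)
qed

lemma inner_L2_eq: "inner f g = (\<integral>x. L2_fun f x * L2_fun g x \<partial>unit_leb)"
  unfolding L2_fun_def inner_L2_def by simp

definition weak_topology :: "'a::real_normed_vector topology"
  where "weak_topology =
    topology_generated_by {f -` U |f U. bounded_linear (f :: 'a \<Rightarrow> real) \<and> open U}"

definition data_topology :: "('a::real_normed_vector \<times> 'a) topology"
  where "data_topology =
    topology_generated_by
      {(A \<times> A') \<inter> {(z, z'). z - z' \<in> C} |A A' C.
         openin weak_topology A \<and> openin weak_topology A' \<and> open C}"

text \<open>Convex-analysis convention (\<open>0\<close> on the set, \<open>\<infinity>\<close> off it), unlike the library's \<open>indicator\<close>.\<close>

definition ind_fun :: "'a set \<Rightarrow> 'a \<Rightarrow> ereal"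
  where "ind_fun S p = (if p \<in> S then 0 else \<infinity>)"

definition is_Gamma_limit :: "'a topology \<Rightarrow> (nat \<Rightarrow> 'a \<Rightarrow> ereal) \<Rightarrow> ('a \<Rightarrow> ereal) \<Rightarrow> bool"
  where "is_Gamma_limit T F G \<longleftrightarrow>
    (\<forall>p \<in> topspace T.
       G p = (SUP U \<in> {U. openin T U \<and> p \<in> U}. liminf (\<lambda>h. INF q\<in>U. F h q)) \<and>
       G p = (SUP U \<in> {U. openin T U \<and> p \<in> U}. limsup (\<lambda>h. INF q\<in>U. F h q)))"

definition is_Kuratowski_limit :: "'a topology \<Rightarrow> (nat \<Rightarrow> 'a set) \<Rightarrow> 'a set \<Rightarrow> bool"
  where "is_Kuratowski_limit T Sh S \<longleftrightarrow> is_Gamma_limit T (\<lambda>h. ind_fun (Sh h)) (ind_fun S)"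

lemma topspace_weak_topology: "topspace weak_topology = UNIV"
proof -
  have "UNIV \<in> {f -` U |f U. bounded_linear (f :: 'a \<Rightarrow> real) \<and> open U}"
    by (rule CollectI, rule exI[of _ "\<lambda>_. 0"], rule exI[of _ UNIV]) auto
  from Union_upper[OF this] show ?thesis
    unfolding weak_topology_def topology_generated_by_topspace by (rule top.extremum_uniqueI)
qed

lemma topspace_data_topology: "topspace data_topology = UNIV"
proof -
  have U: "openin (weak_topology :: 'a topology) UNIV"
    using openin_topspace[of "weak_topology :: 'a topology"]
    by (simp only: topspace_weak_topology)
  have "UNIV \<in> {(A \<times> A') \<inter> {(z, z'). z - z' \<in> C} |A A' (C :: 'a set).
         openin weak_topology A \<and> openin weak_topology A' \<and> open C}"
    by (rule CollectI, rule exI[of _ UNIV], rule exI[of _ UNIV], rule exI[of _ UNIV])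
      (simp add: U)
  from Union_upper[OF this] show ?thesis
    unfolding data_topology_def topology_generated_by_topspace by (rule top.extremum_uniqueI)
qed

type_synonym Z = "L2 \<times> L2"

definition equilibrium_set :: "real \<Rightarrow> Z set"
  where "equilibrium_set eps_bar =
    {(\<epsilon>, \<sigma>). (\<integral>x. L2_fun \<epsilon> x \<partial>unit_leb) = eps_bar \<and>
            (\<exists>s. AE x in unit_leb. L2_fun \<sigma> x = s)}"

definition D_loc :: "real \<Rightarrow> real \<Rightarrow> (real \<times> real) set"
  where "D_loc C \<sigma>0 =
    {(\<epsilon>, C * \<epsilon> + \<sigma>0) |\<epsilon>. \<epsilon> \<le> 0} \<union> {(\<epsilon>, C * \<epsilon> - \<sigma>0) |\<epsilon>. \<epsilon> \<ge> 0}"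

definition Dbar_loc :: "real \<Rightarrow> real \<Rightarrow> (real \<times> real) set"
  where "Dbar_loc C \<sigma>0 =
    {(\<epsilon>, C * \<epsilon> + \<sigma>0) |\<epsilon>. \<epsilon> \<le> - 2 * \<sigma>0 / C} \<union>
    {(\<epsilon>, \<sigma>). - 2 * \<sigma>0 / C \<le> \<epsilon> \<and> \<epsilon> \<le> 0 \<and> \<sigma> \<in> {- \<sigma>0 .. C * \<epsilon> + \<sigma>0}} \<union>
    {(\<epsilon>, \<sigma>). 0 \<le> \<epsilon> \<and> \<epsilon> \<le> 2 * \<sigma>0 / C \<and> \<sigma> \<in> {C * \<epsilon> - \<sigma>0 .. \<sigma>0}} \<union>
    {(\<epsilon>, C * \<epsilon> - \<sigma>0) |\<epsilon>. \<epsilon> \<ge> 2 * \<sigma>0 / C}"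

definition pointwise_in :: "(real \<times> real) set \<Rightarrow> Z set"
  where "pointwise_in K = {(\<epsilon>, \<sigma>). AE x in unit_leb. (L2_fun \<epsilon> x, L2_fun \<sigma> x) \<in> K}"

definition data_set :: "real \<Rightarrow> real \<Rightarrow> Z set"
  where "data_set C \<sigma>0 = pointwise_in (D_loc C \<sigma>0)"

definition relaxed_data_set :: "real \<Rightarrow> real \<Rightarrow> Z set"
  where "relaxed_data_set C \<sigma>0 = pointwise_in (Dbar_loc C \<sigma>0)"

end

theory Submission
  imports Defs
begin

text \<open>For a constant sequence the Kuratowski limit is the topological closure, so the claim is that the
  closure of \<open>D \<times> E\<close> in the data topology is \<open>Dbar \<times> E\<close>.  The topology is not metrizable and the
  sets are unbounded, so the argument works with neighbourhoods instead of sequences.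

  Everything rests on a splitting of the variables.  On \<open>D \<times> E\<close> the stress of the second component is
  constant in \<open>x\<close>, so weak convergence of it is convergence of one real number; together with the
  strong convergence of differences this makes the stress \<open>\<sigma>\<close> of the first component converge
  strongly, while its strain \<open>\<epsilon>\<close> converges only weakly.  Over a fixed stress the local data set
  consists of at most two strains, and strong convergence in \<open>\<sigma>\<close> with weak convergence in \<open>\<epsilon>\<close> fills
  in the interval between them: the section of \<open>Dbar_loc\<close> over \<open>s\<close> is exactly the convex hull
  \<open>[a(s), - a(- s)]\<close> of the section of \<open>D_loc\<close>, where \<open>a\<close> is \<open>lower_branch\<close>.

  The closure is not larger (\<open>closure_of_data_set_subset\<close>): an inequality \<open>\<phi>(\<sigma>) \<le> c \<epsilon>\<close> with \<open>\<phi>\<close> Lipschitz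
  is preserved, because superposition with \<open>\<phi>\<close> is norm continuous on the space and integration
  against a fixed test function is weakly continuous (\<open>closure_of_lipschitz_constraint\<close>).  The
  function \<open>a\<close> may jump, but it is lower semicontinuous and is the supremum of an increasing sequence of
  Lipschitz functions, and countably many such inequalities with \<open>c = 1\<close> and \<open>c = - 1\<close> describe \<open>Dbar_loc\<close>.

  The closure is not smaller (\<open>relaxed_data_set_subset_closure\<close>): a neighbourhood only tests finitely many
  linear functionals, so it is enough to replace \<open>\<epsilon>\<close> by a function that takes the extreme values
  \<open>a(\<sigma>)\<close> and \<open>- a(- \<sigma>)\<close> and that these functionals do not distinguish from \<open>\<epsilon>\<close>
  (\<open>relaxed_data_weakly_approximable\<close>).  The set on which the upper value is taken is chosen by
  prescribing its measure on each common level set of simple approximations of the test functions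
  (\<open>indicator_approximates_density\<close>).  The same change, corrected to have mean zero, is
  made in the strain of the equilibrium component, so the difference moves only by the small mean.
  Functionals are replaced by inner products through an approximate form of the Riesz theorem
  (\<open>bounded_linear_approx_inner\<close>), valid without completeness.\<close>

section \<open>Kuratowski limits of constant sequences\<close>

text \<open>The infimum of the indicator function over a neighbourhood is \<open>0\<close> or \<open>\<infinity>\<close> according to whether
  the neighbourhood meets \<open>S\<close>; its supremum over all neighbourhoods is therefore \<open>0\<close> exactly when
  every neighbourhood meets \<open>S\<close>.\<close>

lemma is_Kuratowski_limit_const:
  "is_Kuratowski_limit T (\<lambda>h. S) (T closure_of S)"
  unfolding is_Kuratowski_limit_def is_Gamma_limit_def
proof
  fix p assume p: "p \<in> topspace T"
  let ?N = "{U. openin T U \<and> p \<in> U}"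
  have INF: "(INF q\<in>U. ind_fun S q) = (if U \<inter> S = {} then \<infinity> else 0)" for U
  proof (cases "U \<inter> S = {}")
    case True
    then show ?thesis
      by (auto simp: ind_fun_def intro!: INF_eqI)
  next
    case False
    then obtain q where q: "q \<in> U" "q \<in> S" by blast
    have "(INF q\<in>U. ind_fun S q) \<le> ind_fun S q"
      using q by (intro INF_lower)
    then have "(INF q\<in>U. ind_fun S q) = 0"
      using q by (intro antisym INF_greatest) (auto simp: ind_fun_def)
    with False show ?thesis by simp
  qed
  have "(SUP U\<in>?N. INF q\<in>U. ind_fun S q) = ind_fun (T closure_of S) p"
  proof (cases "p \<in> T closure_of S")
    case True
    have "(SUP U\<in>?N. INF q\<in>U. ind_fun S q) = (SUP U\<in>?N. 0)"
      using True by (intro SUP_cong) (auto simp: INF in_closure_of)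
    moreover have "?N \<noteq> {}" using p by auto
    ultimately show ?thesis using True by (simp add: ind_fun_def)
  next
    case False
    then obtain U where U: "U \<in> ?N" "U \<inter> S = {}"
      using p by (auto simp: in_closure_of)
    have "(INF q\<in>U. ind_fun S q) = \<infinity>"
      unfolding INF by (rule if_P) (rule U(2))
    then have "\<infinity> \<le> (SUP U\<in>?N. INF q\<in>U. ind_fun S q)"
      by (rule ord_eq_le_trans[OF sym SUP_upper[OF U(1)]])
    moreover have "ind_fun (T closure_of S) p = \<infinity>"
      using False by (simp add: ind_fun_def)
    ultimately show ?thesis
      by (simp only: ereal_infty_less_eq)
  qed
  then show "ind_fun (T closure_of S) p = (SUP U\<in>?N. liminf (\<lambda>h. INF q\<in>U. ind_fun S q)) \<and>
    ind_fun (T closure_of S) p = (SUP U\<in>?N. limsup (\<lambda>h. INF q\<in>U. ind_fun S q))"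
    by (simp add: Liminf_const Limsup_const)
qed

section \<open>Neighbourhoods and continuous functions for the data topology\<close>

text \<open>The sets \<open>U\<close> with \<open>Q U\<close> play the role of a filter that contains the subbasic neighbourhoods
  of \<open>p\<close>; such a filter contains every neighbourhood of \<open>p\<close>.\<close>

lemma generate_topology_on_nhd_induct [consumes 2, case_names Basis Int mono]:
  assumes "generate_topology_on S U" "p \<in> U"
    and "\<And>s. s \<in> S \<Longrightarrow> p \<in> s \<Longrightarrow> Q s"
    and "\<And>a b. Q a \<Longrightarrow> Q b \<Longrightarrow> Q (a \<inter> b)"
    and "\<And>a b. Q a \<Longrightarrow> a \<subseteq> b \<Longrightarrow> Q b"
  shows "Q U"
  using assms(1,2)
proof induction
  case Empty
  then show ?case by simp
next
  case (Int a b)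
  then have "Q a" "Q b" by simp_all
  then show ?case by (rule assms(4))
next
  case (UN K)
  then obtain k where k: "k \<in> K" "p \<in> k" by blast
  then have "Q k" by (rule UN.IH)
  then show ?case using k(1) by (rule assms(5)[OF _ Union_upper])
next
  case (Basis s)
  then show ?case by (rule assms(3))
qed

lemma openin_weak_topology_finite_functionals:
  fixes y :: "'a::real_normed_vector"
  assumes "openin weak_topology A" "y \<in> A"
  shows "\<exists>F \<delta>. finite F \<and> (\<forall>f\<in>F. bounded_linear (f :: 'a \<Rightarrow> real)) \<and> \<delta> > (0::real) \<and>
    (\<forall>y'. (\<forall>f\<in>F. \<bar>f (y' - y)\<bar> < \<delta>) \<longrightarrow> y' \<in> A)"
    (is "\<exists>F \<delta>. ?P F \<delta> A")
proof -
  have "generate_topology_on {f -` U |f U. bounded_linear (f :: 'a \<Rightarrow> real) \<and> open U} A"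
    using assms(1) by (simp add: weak_topology_def openin_topology_generated_by)
  then show ?thesis using assms(2)
  proof (induction rule: generate_topology_on_nhd_induct)
    case (Basis s)
    then obtain f :: "'a \<Rightarrow> real" and U where f: "s = f -` U" "bounded_linear f" "open U"
      by blast
    with Basis have "f y \<in> U" by simp
    then obtain \<delta> where \<delta>: "\<delta> > 0" "ball (f y) \<delta> \<subseteq> U"
      using \<open>open U\<close> openE by blast
    have "?P {f} \<delta> s"
    proof (intro conjI allI impI)
      fix y' assume *: "\<forall>f\<in>{f}. \<bar>f (y' - y)\<bar> < \<delta>"
      have "f (y' - y) = f y' - f y"
        using f(2) by (rule linear_diff[OF bounded_linear.linear])
      then have "f y' \<in> ball (f y) \<delta>"
        using * by (simp add: dist_real_def abs_minus_commute)
      then show "y' \<in> s" using \<delta> f(1) by auto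
    qed (use f \<delta> in simp_all)
    then show ?case by (intro exI)
  next
    case (Int a b)
    obtain F \<delta> where F: "?P F \<delta> a"
      using Int(1) by (elim exE) (rule that)
    obtain G \<eta> where G: "?P G \<eta> b"
      using Int(2) by (elim exE) (rule that)
    have "?P (F \<union> G) (min \<delta> \<eta>) (a \<inter> b)"
    proof (intro conjI allI impI)
      fix y' assume *: "\<forall>f\<in>F \<union> G. \<bar>f (y' - y)\<bar> < min \<delta> \<eta>"
      show "y' \<in> a \<inter> b"
        using F[THEN conjunct2, THEN conjunct2, THEN conjunct2, rule_format, of y']
          G[THEN conjunct2, THEN conjunct2, THEN conjunct2, rule_format, of y'] * by simp
    next
      show "\<forall>f\<in>F \<union> G. bounded_linear f" using F G by blast
    next
      show "finite (F \<union> G)" using F G by blast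
    next
      show "min \<delta> \<eta> > 0"
        using conjunct1[OF conjunct2[OF conjunct2[OF F]]] conjunct1[OF conjunct2[OF conjunct2[OF G]]] by simp
    qed
    then show ?case by (intro exI)
  next
    case (mono a b)
    obtain F \<delta> where F: "?P F \<delta> a"
      using mono(1) by (elim exE) (rule that)
    then have "?P F \<delta> b" using mono(2) by blast
    then show ?case by (intro exI)
  qed
qed

text \<open>This is what makes a recovery construction possible: a neighbourhood sees the two components
  only through finitely many functionals, besides the norm of the change of their difference.\<close>

lemma openin_data_topology_finite_functionals:
  fixes y z :: "'a::real_normed_vector"
  assumes "openin data_topology U" "(y, z) \<in> U"
  shows "\<exists>F \<delta>. finite F \<and> (\<forall>f\<in>F. bounded_linear (f :: 'a \<Rightarrow> real)) \<and> \<delta> > (0::real) \<and>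
    (\<forall>y' z'. (\<forall>f\<in>F. \<bar>f (y' - y)\<bar> < \<delta>) \<and> (\<forall>f\<in>F. \<bar>f (z' - z)\<bar> < \<delta>) \<and>
      norm ((y' - z') - (y - z)) < \<delta> \<longrightarrow> (y', z') \<in> U)"
    (is "\<exists>F \<delta>. ?P F \<delta> U")
proof -
  have "generate_topology_on {(A \<times> A') \<inter> {(z, z'). z - z' \<in> C} |A A' (C :: 'a set).
         openin weak_topology A \<and> openin weak_topology A' \<and> open C} U"
    using assms(1) by (simp add: data_topology_def openin_topology_generated_by)
  then show ?thesis using assms(2)
  proof (induction rule: generate_topology_on_nhd_induct)
    case (Basis s)
    then obtain A A' C where s: "s = (A \<times> A') \<inter> {(z, z'). z - z' \<in> C}"
      "openin weak_topology A" "openin weak_topology A'" "open C"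
      by blast
    with Basis(2) have "y \<in> A" "z \<in> A'" "y - z \<in> C" by auto
    obtain \<gamma> where \<gamma>: "\<gamma> > 0" "ball (y - z) \<gamma> \<subseteq> C"
      using \<open>open C\<close> \<open>y - z \<in> C\<close> openE by blast
    obtain F \<delta> where F: "finite F" "\<forall>f\<in>F. bounded_linear f" "\<delta> > (0::real)"
      "\<forall>y'. (\<forall>f\<in>F. \<bar>f (y' - y)\<bar> < \<delta>) \<longrightarrow> y' \<in> A"
      using openin_weak_topology_finite_functionals[OF s(2) \<open>y \<in> A\<close>] by blast
    obtain G \<eta> where G: "finite G" "\<forall>f\<in>G. bounded_linear f" "\<eta> > (0::real)"
      "\<forall>z'. (\<forall>f\<in>G. \<bar>f (z' - z)\<bar> < \<eta>) \<longrightarrow> z' \<in> A'"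
      using openin_weak_topology_finite_functionals[OF s(3) \<open>z \<in> A'\<close>] by blast
    have "?P (F \<union> G) (min \<gamma> (min \<delta> \<eta>)) s"
    proof (intro conjI allI impI)
      fix y' z'
      assume *: "(\<forall>f\<in>F \<union> G. \<bar>f (y' - y)\<bar> < min \<gamma> (min \<delta> \<eta>)) \<and>
        (\<forall>f\<in>F \<union> G. \<bar>f (z' - z)\<bar> < min \<gamma> (min \<delta> \<eta>)) \<and>
        norm ((y' - z') - (y - z)) < min \<gamma> (min \<delta> \<eta>)"
      then have "y' - z' \<in> ball (y - z) \<gamma>"
        by (simp add: dist_norm norm_minus_commute)
      moreover have "y' \<in> A"
        using F(4)[rule_format, of y'] * by simp
      moreover have "z' \<in> A'"
        using G(4)[rule_format, of z'] * by simp
      ultimately show "(y', z') \<in> s"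
        using \<gamma> by (auto simp: s(1))
    next
      show "\<forall>f\<in>F \<union> G. bounded_linear f" using F G by blast
    qed (use \<gamma> F(1,3) G(1,3) in simp_all)
    then show ?case by (intro exI)
  next
    case (Int a b)
    obtain F \<delta> where F: "?P F \<delta> a"
      using Int(1) by (elim exE) (rule that)
    obtain G \<eta> where G: "?P G \<eta> b"
      using Int(2) by (elim exE) (rule that)
    have "?P (F \<union> G) (min \<delta> \<eta>) (a \<inter> b)"
    proof (intro conjI allI impI)
      fix y' z'
      assume *: "(\<forall>f\<in>F \<union> G. \<bar>f (y' - y)\<bar> < min \<delta> \<eta>) \<and>
        (\<forall>f\<in>F \<union> G. \<bar>f (z' - z)\<bar> < min \<delta> \<eta>) \<and> norm ((y' - z') - (y - z)) < min \<delta> \<eta>"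
      show "(y', z') \<in> a \<inter> b"
        using F[THEN conjunct2, THEN conjunct2, THEN conjunct2, rule_format, of y' z']
          G[THEN conjunct2, THEN conjunct2, THEN conjunct2, rule_format, of y' z'] * by simp
    next
      show "\<forall>f\<in>F \<union> G. bounded_linear f" using F G by blast
    next
      show "finite (F \<union> G)" using F G by blast
    next
      show "min \<delta> \<eta> > 0" using conjunct1[OF conjunct2[OF conjunct2[OF F]]] conjunct1[OF conjunct2[OF conjunct2[OF G]]] by simp
    qed
    then show ?case by (intro exI)
  next
    case (mono a b)
    obtain F \<delta> where F: "?P F \<delta> a"
      using mono(1) by (elim exE) (rule that)
    then have "?P F \<delta> b" using mono(2) by blast
    then show ?case by (intro exI)
  qed
qed

lemma openin_weak_topology_vimage:
  assumes "bounded_linear (f :: 'a::real_normed_vector \<Rightarrow> real)" "open U"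
  shows "openin weak_topology (f -` U)"
  unfolding weak_topology_def by (rule topology_generated_by_Basis) (use assms in blast)

lemma openin_data_topology_basic:
  assumes "openin weak_topology A" "openin weak_topology A'" "open C"
  shows "openin data_topology ((A \<times> A') \<inter> {(z, z'). z - z' \<in> C})"
  unfolding data_topology_def by (rule topology_generated_by_Basis) (use assms in blast)

lemma openin_weak_topology_UNIV: "openin weak_topology UNIV"
  by (metis openin_topspace topspace_weak_topology)

lemma continuous_map_data_topology_fst:
  assumes "bounded_linear (f :: 'a::real_normed_vector \<Rightarrow> real)"
  shows "continuous_map data_topology euclidean (\<lambda>p. f (fst p))"
  unfolding continuous_map_def topspace_data_topology
proof safe
  fix U :: "real set"
  assume "openin euclidean U"
  then have "open U" by simp
  have "{p \<in> UNIV. f (fst p) \<in> U} = ((f -` U) \<times> UNIV) \<inter> {(z, z'). z - z' \<in> UNIV}"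
    by auto
  then show "openin data_topology {p \<in> UNIV. f (fst p) \<in> U}"
    using openin_data_topology_basic[OF openin_weak_topology_vimage[OF assms \<open>open U\<close>] openin_weak_topology_UNIV open_UNIV]
    by (simp only:)
qed simp

lemma continuous_map_data_topology_snd:
  assumes "bounded_linear (f :: 'a::real_normed_vector \<Rightarrow> real)"
  shows "continuous_map data_topology euclidean (\<lambda>p. f (snd p))"
  unfolding continuous_map_def topspace_data_topology
proof safe
  fix U :: "real set"
  assume "openin euclidean U"
  then have "open U" by simp
  have "{p \<in> UNIV. f (snd p) \<in> U} = (UNIV \<times> (f -` U)) \<inter> {(z, z'). z - z' \<in> UNIV}"
    by auto
  then show "openin data_topology {p \<in> UNIV. f (snd p) \<in> U}"
    using openin_data_topology_basic[OF openin_weak_topology_UNIV openin_weak_topology_vimage[OF assms \<open>open U\<close>] open_UNIV]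
    by (simp only:)
qed simp

lemma continuous_map_data_topology_diff:
  "continuous_map data_topology euclidean (\<lambda>p. fst p - snd p :: 'a::real_normed_vector)"
  unfolding continuous_map_def topspace_data_topology
proof safe
  fix U :: "'a set"
  assume "openin euclidean U"
  then have "open U" by simp
  have "{p \<in> UNIV. fst p - snd p \<in> U} = (UNIV \<times> UNIV) \<inter> {(z, z'). z - z' \<in> U}"
    by auto
  then show "openin data_topology {p \<in> UNIV. fst p - snd p \<in> U}"
    using openin_data_topology_basic[OF openin_weak_topology_UNIV openin_weak_topology_UNIV \<open>open U\<close>]
    by (simp only:)
qed simp

lemma continuous_map_closure_of_mem:
  assumes "continuous_map T euclidean f" "closed K" "f ` S \<subseteq> K" "p \<in> T closure_of S"
  shows "f p \<in> K"
proof -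
  have "f p \<in> euclidean closure_of (f ` S)"
    using continuous_map_image_closure_subset[OF assms(1), of S] assms(4) by blast
  then show ?thesis
    using closure_minimal[OF assms(3,2)] by (auto simp: euclidean_closure_of)
qed

section \<open>Bounded functionals are nearly inner products\<close>

text \<open>Density of the inner product functionals in the dual of an inner product space, which is the part of
  the Riesz theorem that survives without completeness.  If \<open>v\<close> is a unit vector at which \<open>f\<close> almost
  attains its norm \<open>M\<close>, then \<open>f\<close> is small on the orthogonal complement of \<open>v\<close>, since
  \<open>(f v)\<^sup>2 + (f w)\<^sup>2 \<le> M\<^sup>2\<close> for unit vectors \<open>w\<close> orthogonal to \<open>v\<close>.  Hence \<open>u = f v *\<^sub>R v\<close> works.\<close>

lemma bounded_linear_approx_inner:
  fixes f :: "'a::real_inner \<Rightarrow> real"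
  assumes "bounded_linear f" "\<eta> > 0"
  obtains u where "\<And>w. \<bar>f w - inner u w\<bar> \<le> \<eta> * norm w"
proof -
  interpret bounded_linear f by fact
  define M where "M = onorm f"
  have M: "\<bar>f w\<bar> \<le> M * norm w" for w
    using onorm[OF assms(1), of w] by (simp add: M_def)
  have "M \<ge> 0" using onorm_pos_le[OF assms(1)] by (simp add: M_def)
  \<comment> \<open>For \<open>M \<le> \<eta>\<close> the choice \<open>v = 0\<close> is good enough and also covers \<open>f = 0\<close>.\<close>
  obtain v where v: "norm v \<le> 1" "M\<^sup>2 - (f v)\<^sup>2 \<le> \<eta>\<^sup>2" "v \<noteq> 0 \<longrightarrow> norm v = 1"
  proof (cases "M \<le> \<eta>")
    case True
    with \<open>M \<ge> 0\<close> show thesis by (intro that[of 0]) (auto intro: power_mono simp: zero)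
  next
    case False
    define t where "t = sqrt (M\<^sup>2 - \<eta>\<^sup>2)"
    have "0 < M\<^sup>2 - \<eta>\<^sup>2" using False assms(2) by (simp add: power2_less_imp_less power_strict_mono)
    have t: "t < M"
    proof -
      have "t < sqrt (M\<^sup>2)" unfolding t_def using assms(2) by (intro real_sqrt_less_mono) simp
      then show ?thesis using \<open>M \<ge> 0\<close> by simp
    qed
    have t0: "t \<ge> 0" using \<open>0 < M\<^sup>2 - \<eta>\<^sup>2\<close> by (simp add: t_def)
    obtain x where x: "\<not> norm (f x) \<le> t * norm x"
      using onorm_bound[of t f] t t0 by (force simp: M_def)
    then have "x \<noteq> 0" by (auto simp: zero)
    have "t < \<bar>f (x /\<^sub>R norm x)\<bar>"
      using x \<open>x \<noteq> 0\<close> by (simp add: scaleR abs_mult field_simps)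
    then have "t\<^sup>2 \<le> (f (x /\<^sub>R norm x))\<^sup>2"
      using t0 by (metis abs_le_square_iff abs_of_nonneg less_imp_le)
    then show thesis
      using \<open>0 < M\<^sup>2 - \<eta>\<^sup>2\<close> \<open>x \<noteq> 0\<close> by (intro that[of "x /\<^sub>R norm x"]) (auto simp: t_def)
  qed
  show thesis
  proof (rule that[of "f v *\<^sub>R v"])
    fix w
    define w' where "w' = w - inner v w *\<^sub>R v"
    have vw': "inner v w' = 0"
      using v(3) by (cases "v = 0") (auto simp: w'_def inner_diff_right dot_square_norm)
    have fw': "f w - inner (f v *\<^sub>R v) w = f w'"
      by (simp add: w'_def diff scaleR)
    have "norm w' \<le> norm w"
    proof -
      have "w = w' + inner v w *\<^sub>R v" by (simp add: w'_def)
      then have "(norm w)\<^sup>2 = (norm w')\<^sup>2 + (norm (inner v w *\<^sub>R v))\<^sup>2"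
        using vw' by (metis inner_commute inner_scaleR_right mult_zero_right norm_add_Pythagorean orthogonal_def)
      then show ?thesis
        by (metis le_add_same_cancel1 norm_ge_zero power2_le_imp_le zero_le_power2)
    qed
    have "(f w')\<^sup>2 \<le> \<eta>\<^sup>2 * (norm w')\<^sup>2"
    proof (cases "w' = 0")
      case True
      then show ?thesis by (simp add: zero)
    next
      case False
      \<comment> \<open>The vector \<open>q\<close> represents \<open>f\<close> on the span of \<open>v\<close> and \<open>w'\<close>, so that \<open>f q\<close> is
        the squared norm of \<open>q\<close>, and \<open>f q \<le> M * norm q\<close> bounds that norm by \<open>M\<close>.\<close>
      define c where "c = f w' / (norm w')\<^sup>2"
      define q where "q = f v *\<^sub>R v + c *\<^sub>R w'"
      define s where "s = (f v)\<^sup>2 + (f w')\<^sup>2 / (norm w')\<^sup>2"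
      have fq: "f q = s"
        by (simp add: q_def s_def c_def add scaleR power2_eq_square)
      have "(norm q)\<^sup>2 = (f v)\<^sup>2 * (norm v)\<^sup>2 + c\<^sup>2 * (norm w')\<^sup>2"
        unfolding power2_norm_eq_inner q_def using vw'
        by (simp add: inner_add_left inner_add_right inner_commute[of w' v] power2_eq_square)
      also have "\<dots> \<le> s"
      proof -
        have "(f v)\<^sup>2 * (norm v)\<^sup>2 \<le> (f v)\<^sup>2 * 1"
          using v(1) by (intro mult_left_mono) (auto simp: power_le_one)
        moreover have "c\<^sup>2 * (norm w')\<^sup>2 = (f w')\<^sup>2 / (norm w')\<^sup>2"
          using False by (simp add: c_def power2_eq_square)
        ultimately show ?thesis by (simp add: s_def)
      qed
      finally have nq: "(norm q)\<^sup>2 \<le> s" .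
      have s0: "s \<ge> 0" by (simp add: s_def)
      have "s\<^sup>2 \<le> (M * norm q)\<^sup>2"
        using M[of q] fq s0 by (intro power_mono) auto
      also have "\<dots> \<le> M\<^sup>2 * s"
        using nq by (simp add: power_mult_distrib mult_left_mono)
      finally have "s \<le> M\<^sup>2"
        using s0 by (cases "s = 0") (auto simp: power2_eq_square)
      then have "(f w')\<^sup>2 / (norm w')\<^sup>2 \<le> \<eta>\<^sup>2"
        using v(2) by (simp add: s_def)
      then show ?thesis using False by (simp add: field_simps)
    qed
    then have "(f w')\<^sup>2 \<le> (\<eta> * norm w')\<^sup>2" by (simp add: power_mult_distrib)
    then have "\<bar>f w'\<bar> \<le> \<eta> * norm w'"
      using assms(2) by (simp add: abs_le_square_iff[symmetric] abs_mult)
    also have "\<dots> \<le> \<eta> * norm w"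
      using \<open>norm w' \<le> norm w\<close> assms(2) by simp
    finally show "\<bar>f w - inner (f v *\<^sub>R v) w\<bar> \<le> \<eta> * norm w"
      by (simp only: fw')
  qed
qed

section \<open>The space L2 and its representatives\<close>

lemma L2_fun_measurable [measurable]: "L2_fun f \<in> borel_measurable unit_leb"
  using sq_integrable_L2_fun[of f] by (simp add: sq_integrable_def)

lemma finite_measure_unit_leb: "finite_measure unit_leb"
  by (rule finite_measure_lebesgue_on) simp

lemma measure_unit_leb: "measure unit_leb (space unit_leb) = 1"
  by (simp add: measure_restrict_space)

lemma sq_integrable_const: "sq_integrable (\<lambda>_. c)"
  unfolding sq_integrable_def
  using finite_measure.integrable_const[OF finite_measure_unit_leb] by simp

lemma sq_integrable_mono:
  assumes "sq_integrable g" "f \<in> borel_measurable unit_leb" "\<And>x. \<bar>f x\<bar> \<le> \<bar>g x\<bar>"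
  shows "sq_integrable f"
  unfolding sq_integrable_def
proof
  show "integrable unit_leb (\<lambda>x. (f x)\<^sup>2)"
  proof (rule Bochner_Integration.integrable_bound)
    show "integrable unit_leb (\<lambda>x. (g x)\<^sup>2)"
      using assms(1) by (simp add: sq_integrable_def)
    show "(\<lambda>x. (f x)\<^sup>2) \<in> borel_measurable unit_leb"
      using assms(2) by measurable
    show "AE x in unit_leb. norm ((f x)\<^sup>2) \<le> norm ((g x)\<^sup>2)"
      using assms(3) by (simp add: abs_le_square_iff)
  qed
qed fact

lemma sq_integrable_abs: "sq_integrable f \<Longrightarrow> sq_integrable (\<lambda>x. \<bar>f x\<bar>)"
  by (rule sq_integrable_mono[of f]) (auto simp: sq_integrable_def)

lemma L2_eqI:
  assumes "AE x in unit_leb. L2_fun f x = L2_fun g x"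
  shows "f = g"
proof -
  have "L2_rel (L2_fun f) (L2_fun g)"
    using assms sq_integrable_L2_fun by (simp add: L2_rel_def)
  then have "abs_L2 (L2_fun f) = abs_L2 (L2_fun g)"
    by (rule Quotient3_rel_abs[OF Quotient3_L2])
  then show ?thesis by (simp add: abs_L2_L2_fun)
qed

lemma L2_rel_L2_fun: "L2_rel (L2_fun f) (L2_fun f)"
  by (simp add: L2_rel_def sq_integrable_L2_fun)

lemma AE_L2_fun_add: "AE x in unit_leb. L2_fun (f + g) x = L2_fun f x + L2_fun g x"
proof -
  have "f + g = abs_L2 (\<lambda>x. L2_fun f x + L2_fun g x)"
    using plus_L2.abs_eq[OF L2_rel_L2_fun[of f] L2_rel_L2_fun[of g]] by (simp add: abs_L2_L2_fun)
  then show ?thesis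
    using AE_L2_fun_abs_L2[OF sq_integrable_add[OF sq_integrable_L2_fun[of f] sq_integrable_L2_fun[of g]]]
    by simp
qed

lemma AE_L2_fun_scaleR: "AE x in unit_leb. L2_fun (c *\<^sub>R f) x = c * L2_fun f x"
proof -
  have "c *\<^sub>R f = abs_L2 (\<lambda>x. c * L2_fun f x)"
    using scaleR_L2.abs_eq[OF L2_rel_L2_fun[of f], of c] by (simp add: abs_L2_L2_fun)
  then show ?thesis
    using AE_L2_fun_abs_L2[OF sq_integrable_scale[OF sq_integrable_L2_fun[of f]]]
    by simp
qed

lemma AE_L2_fun_diff: "AE x in unit_leb. L2_fun (f - g) x = L2_fun f x - L2_fun g x"
proof -
  have "f - g = f + (- 1) *\<^sub>R g" by simp
  then show ?thesis
    using AE_L2_fun_add[of f "(- 1) *\<^sub>R g"] AE_L2_fun_scaleR[of "- 1" g] by (auto elim: eventually_elim2)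
qed

definition L2_one :: L2
  where "L2_one = abs_L2 (\<lambda>_. 1)"

lemma AE_L2_fun_one: "AE x in unit_leb. L2_fun L2_one x = 1"
  unfolding L2_one_def by (rule AE_L2_fun_abs_L2[OF sq_integrable_const])

lemma inner_L2_one: "inner f L2_one = (\<integral>x. L2_fun f x \<partial>unit_leb)"
  unfolding inner_L2_eq
proof (rule integral_cong_AE)
  show "AE x in unit_leb. L2_fun f x * L2_fun L2_one x = L2_fun f x"
    using AE_L2_fun_one by eventually_elim simp
qed auto

lemma inner_L2_one_one: "inner L2_one L2_one = 1"
proof -
  have "inner L2_one L2_one = (\<integral>x. 1 \<partial>unit_leb)"
    unfolding inner_L2_one by (rule integral_cong_AE) (use AE_L2_fun_one in auto)
  then show ?thesis using measure_unit_leb by simp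
qed

lemma norm_L2_one: "norm L2_one = 1"
  by (simp add: norm_eq_sqrt_inner inner_L2_one_one)

lemma norm_L2_mono:
  assumes "AE x in unit_leb. \<bar>L2_fun f x\<bar> \<le> \<bar>L2_fun g x\<bar>"
  shows "norm f \<le> norm g"
proof -
  have "inner f f \<le> inner g g"
    unfolding inner_L2_eq
  proof (rule integral_mono_AE)
    show "AE x in unit_leb. L2_fun f x * L2_fun f x \<le> L2_fun g x * L2_fun g x"
      using assms
    proof eventually_elim
      case (elim x)
      then have "\<bar>L2_fun f x\<bar> * \<bar>L2_fun f x\<bar> \<le> \<bar>L2_fun g x\<bar> * \<bar>L2_fun g x\<bar>"
        by (intro mult_mono) auto
      then show ?case by simp
    qed
  qed (use sq_integrable_mult[OF sq_integrable_L2_fun sq_integrable_L2_fun] in auto)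
  then show ?thesis by (simp add: norm_eq_sqrt_inner)
qed

lemma inner_L2_mono:
  assumes "AE x in unit_leb. L2_fun f x \<le> L2_fun g x" "AE x in unit_leb. L2_fun h x \<ge> 0"
  shows "inner f h \<le> inner g h"
  unfolding inner_L2_eq
proof (rule integral_mono_AE)
  show "AE x in unit_leb. L2_fun f x * L2_fun h x \<le> L2_fun g x * L2_fun h x"
    using assms by eventually_elim (rule mult_right_mono)
qed (use sq_integrable_mult[OF sq_integrable_L2_fun sq_integrable_L2_fun] in auto)

text \<open>Equilibrium in Hilbert space terms: the stress equals its projection onto the constants.  The
  equation is oriented so that it can be used for rewriting.\<close>

lemma equilibrium_set_iff:
  "(\<epsilon>, \<sigma>) \<in> equilibrium_set eps_bar \<longleftrightarrow>
    inner \<epsilon> L2_one = eps_bar \<and> inner \<sigma> L2_one *\<^sub>R L2_one = \<sigma>"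
proof -
  have c: "AE x in unit_leb. L2_fun (s *\<^sub>R L2_one) x = s" for s
    using AE_L2_fun_scaleR[of s L2_one] AE_L2_fun_one by eventually_elim simp
  have "inner \<sigma> L2_one *\<^sub>R L2_one = \<sigma>" if s: "AE x in unit_leb. L2_fun \<sigma> x = s" for s
  proof -
    have "\<sigma> = s *\<^sub>R L2_one"
      by (rule L2_eqI) (use s c[of s] in \<open>eventually_elim, simp\<close>)
    then show ?thesis by (simp add: inner_L2_one_one)
  qed
  moreover have "\<exists>s. AE x in unit_leb. L2_fun \<sigma> x = s" if "inner \<sigma> L2_one *\<^sub>R L2_one = \<sigma>"
    using c[of "inner \<sigma> L2_one"] that by metis
  ultimately show ?thesis
    by (auto simp: equilibrium_set_def inner_L2_one)
qed

section \<open>Superposition with a Lipschitz function\<close>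

lemma sq_integrable_lipschitz:
  assumes "L-lipschitz_on UNIV (\<phi> :: real \<Rightarrow> real)"
  shows "sq_integrable (\<lambda>x. \<phi> (L2_fun u x))"
proof (rule sq_integrable_mono)
  show "sq_integrable (\<lambda>x. \<bar>\<phi> 0\<bar> + L * \<bar>L2_fun u x\<bar>)"
    by (intro sq_integrable_add sq_integrable_const sq_integrable_scale sq_integrable_abs sq_integrable_L2_fun)
  have "\<phi> \<in> borel_measurable borel"
    using lipschitz_on_continuous_on[OF assms] by (rule borel_measurable_continuous_onI)
  then show "(\<lambda>x. \<phi> (L2_fun u x)) \<in> borel_measurable unit_leb"
    by measurable
  fix x
  have "\<bar>\<phi> (L2_fun u x) - \<phi> 0\<bar> \<le> L * \<bar>L2_fun u x\<bar>"
    using lipschitz_onD[OF assms, of "L2_fun u x" 0] by (simp add: dist_real_def)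
  then show "\<bar>\<phi> (L2_fun u x)\<bar> \<le> \<bar>\<bar>\<phi> 0\<bar> + L * \<bar>L2_fun u x\<bar>\<bar>"
    by linarith
qed

definition L2_compose :: "(real \<Rightarrow> real) \<Rightarrow> L2 \<Rightarrow> L2"
  where "L2_compose \<phi> u = abs_L2 (\<lambda>x. \<phi> (L2_fun u x))"

lemma AE_L2_fun_compose:
  assumes "L-lipschitz_on UNIV \<phi>"
  shows "AE x in unit_leb. L2_fun (L2_compose \<phi> u) x = \<phi> (L2_fun u x)"
  unfolding L2_compose_def by (rule AE_L2_fun_abs_L2[OF sq_integrable_lipschitz[OF assms]])

text \<open>The superposition operator inherits the Lipschitz constant, by comparing pointwise.\<close>

lemma continuous_on_L2_compose:
  assumes "L-lipschitz_on UNIV \<phi>"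
  shows "continuous_on UNIV (L2_compose \<phi>)"
proof -
  have "L-lipschitz_on UNIV (L2_compose \<phi>)"
  proof (rule lipschitz_onI)
    show L: "0 \<le> L" using assms by (rule lipschitz_on_nonneg)
    fix u v
    have "norm (L2_compose \<phi> u - L2_compose \<phi> v) \<le> norm (L *\<^sub>R (u - v))"
    proof (rule norm_L2_mono)
      show "AE x in unit_leb. \<bar>L2_fun (L2_compose \<phi> u - L2_compose \<phi> v) x\<bar> \<le> \<bar>L2_fun (L *\<^sub>R (u - v)) x\<bar>"
        using AE_L2_fun_diff[of "L2_compose \<phi> u" "L2_compose \<phi> v"] AE_L2_fun_compose[OF assms, of u]
          AE_L2_fun_compose[OF assms, of v] AE_L2_fun_scaleR[of L "u - v"] AE_L2_fun_diff[of u v]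
      proof eventually_elim
        case (elim x)
        then show ?case
          using lipschitz_onD[OF assms, of "L2_fun u x" "L2_fun v x"] L
          by (simp add: dist_real_def abs_mult)
      qed
    qed
    then show "dist (L2_compose \<phi> u) (L2_compose \<phi> v) \<le> L * dist u v"
      using L by (simp add: dist_norm)
  qed
  then show ?thesis by (rule lipschitz_on_continuous_on)
qed

section \<open>Constraints that pass to the closure\<close>

text \<open>Each defining condition is a linear equation, or a family of them indexed by a test vector \<open>h\<close>,
  and thus weakly closed.\<close>

lemma closure_of_equilibrium:
  assumes "((\<epsilon>, \<sigma>), (\<epsilon>', \<sigma>')) \<in> data_topology closure_of (Y \<times> equilibrium_set eps_bar)"
  shows "(\<epsilon>', \<sigma>') \<in> equilibrium_set eps_bar"
proof -
  have 1: "inner \<epsilon>' L2_one = eps_bar"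
  proof -
    have "bounded_linear (\<lambda>p :: Z. inner (fst p) L2_one)"
      by (intro bounded_linear_intros)
    note cont = continuous_map_data_topology_snd[OF this]
    have "(\<lambda>p :: Z \<times> Z. inner (fst (snd p)) L2_one) ` (Y \<times> equilibrium_set eps_bar) \<subseteq> {eps_bar}"
      by (auto simp: equilibrium_set_iff)
    from continuous_map_closure_of_mem[OF cont _ this assms] show ?thesis by simp
  qed
  have 2: "inner (\<sigma>' - inner \<sigma>' L2_one *\<^sub>R L2_one) h = 0" for h
  proof -
    have "bounded_linear (\<lambda>p :: Z. inner (snd p - inner (snd p) L2_one *\<^sub>R L2_one) h)"
      by (intro bounded_linear_intros)
    note cont = continuous_map_data_topology_snd[OF this]
    have "(\<lambda>p :: Z \<times> Z. inner (snd (snd p) - inner (snd (snd p)) L2_one *\<^sub>R L2_one) h) `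
        (Y \<times> equilibrium_set eps_bar) \<subseteq> {0}"
      by (auto simp: equilibrium_set_iff)
    from continuous_map_closure_of_mem[OF cont _ this assms] show ?thesis by simp
  qed
  then have "\<sigma>' - inner \<sigma>' L2_one *\<^sub>R L2_one = 0"
    by (metis inner_eq_zero_iff)
  with 1 show ?thesis by (simp add: equilibrium_set_iff)
qed

text \<open>The nonlinear function \<open>\<phi>\<close> is applied to the stress, which has to be recovered as a strongly
  continuous function of the whole pair.  The map \<open>R\<close> below does this: it adds to the difference of
  the stresses the mean of the second stress, and on equilibrium states it returns the first stress.
  The inequality is then tested against its own violation \<open>g\<close>, the positive part
  of \<open>\<phi>(\<sigma>) - c \<epsilon>\<close>: this gives \<open>inner g g \<le> 0\<close>.\<close>

lemma closure_of_lipschitz_constraint: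
  assumes "L-lipschitz_on UNIV \<phi>" and K: "\<And>e s. (e, s) \<in> K \<Longrightarrow> \<phi> s \<le> c * e"
    and cl: "((\<epsilon>, \<sigma>), (\<epsilon>', \<sigma>')) \<in> data_topology closure_of (pointwise_in K \<times> equilibrium_set eps_bar)"
  shows "AE x in unit_leb. \<phi> (L2_fun \<sigma> x) \<le> c * L2_fun \<epsilon> x"
proof -
  define R :: "Z \<times> Z \<Rightarrow> L2"
    where "R p = snd (fst p - snd p) + inner (snd (snd p)) L2_one *\<^sub>R L2_one" for p
  have R: "R ((e, s), (e', s')) = s" if "(e', s') \<in> equilibrium_set eps_bar" for e s e' s'
    using that by (simp add: R_def equilibrium_set_iff)
  have contR: "continuous_map data_topology euclidean R"
  proof -
    have "continuous_map data_topology euclidean (\<lambda>p :: Z \<times> Z. snd (fst p - snd p))"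
      using continuous_map_compose[OF continuous_map_data_topology_diff, of euclidean "snd :: Z \<Rightarrow> L2"]
      by (simp add: o_def continuous_on_snd continuous_on_id)
    moreover have "continuous_map data_topology euclidean (\<lambda>p :: Z \<times> Z. inner (snd (snd p)) L2_one)"
      by (rule continuous_map_data_topology_snd) (intro bounded_linear_intros)
    then have "continuous_map data_topology euclidean (\<lambda>p :: Z \<times> Z. inner (snd (snd p)) L2_one *\<^sub>R L2_one)"
      using continuous_map_compose[of data_topology euclidean "\<lambda>p :: Z \<times> Z. inner (snd (snd p)) L2_one" euclidean "\<lambda>t. t *\<^sub>R L2_one"]
      by (simp add: o_def continuous_on_scaleR continuous_on_id continuous_on_const)
    ultimately show ?thesis
      unfolding R_def by (rule continuous_map_add)
  qed
  define g where "g = abs_L2 (\<lambda>x. max 0 (L2_fun (L2_compose \<phi> \<sigma> - c *\<^sub>R \<epsilon>) x))"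
  have g: "AE x in unit_leb. L2_fun g x = max 0 (L2_fun (L2_compose \<phi> \<sigma> - c *\<^sub>R \<epsilon>) x)"
    unfolding g_def
    by (rule AE_L2_fun_abs_L2, rule sq_integrable_mono[OF sq_integrable_L2_fun[of "L2_compose \<phi> \<sigma> - c *\<^sub>R \<epsilon>"]]) auto
  define G :: "Z \<times> Z \<Rightarrow> real"
    where "G p = inner (L2_compose \<phi> (R p)) g - inner (c *\<^sub>R fst (fst p)) g" for p
  have "continuous_map data_topology euclidean G"
    unfolding G_def
  proof (rule continuous_map_diff)
    have "continuous_on UNIV (\<lambda>u. inner (L2_compose \<phi> u) g)"
      using continuous_on_L2_compose[OF assms(1)] by (intro continuous_intros)
    then show "continuous_map data_topology euclidean (\<lambda>p. inner (L2_compose \<phi> (R p)) g)"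
      using continuous_map_compose[OF contR, of euclidean "\<lambda>u. inner (L2_compose \<phi> u) g"]
      by (simp add: o_def)
    show "continuous_map data_topology euclidean (\<lambda>p :: Z \<times> Z. inner (c *\<^sub>R fst (fst p)) g)"
      by (rule continuous_map_data_topology_fst) (intro bounded_linear_intros)
  qed
  moreover have "G ` (pointwise_in K \<times> equilibrium_set eps_bar) \<subseteq> {..0}"
  proof safe
    fix e s e' s'
    assume es: "(e, s) \<in> pointwise_in K" and "(e', s') \<in> equilibrium_set eps_bar"
    have "inner (L2_compose \<phi> s) g \<le> inner (c *\<^sub>R e) g"
    proof (rule inner_L2_mono)
      show "AE x in unit_leb. 0 \<le> L2_fun g x"
        using g by eventually_elim simp
      have "AE x in unit_leb. (L2_fun e x, L2_fun s x) \<in> K"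
        using es by (simp add: pointwise_in_def)
      then show "AE x in unit_leb. L2_fun (L2_compose \<phi> s) x \<le> L2_fun (c *\<^sub>R e) x"
        using AE_L2_fun_compose[OF assms(1), of s] AE_L2_fun_scaleR[of c e]
        by eventually_elim (simp add: K)
    qed
    then show "G ((e, s), (e', s')) \<le> 0"
      using R[OF \<open>(e', s') \<in> _\<close>] by (simp add: G_def)
  qed
  ultimately have "G ((\<epsilon>, \<sigma>), (\<epsilon>', \<sigma>')) \<le> 0"
    using continuous_map_closure_of_mem[OF _ closed_atMost _ cl] by blast
  then have "inner (L2_compose \<phi> \<sigma> - c *\<^sub>R \<epsilon>) g \<le> 0"
    using R[OF closure_of_equilibrium[OF cl]] by (simp add: G_def inner_diff_left)
  moreover have "inner (L2_compose \<phi> \<sigma> - c *\<^sub>R \<epsilon>) g = inner g g"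
    unfolding inner_L2_eq
  proof (rule integral_cong_AE)
    show "AE x in unit_leb. L2_fun (L2_compose \<phi> \<sigma> - c *\<^sub>R \<epsilon>) x * L2_fun g x = L2_fun g x * L2_fun g x"
      using g by eventually_elim (simp add: max_def)
  qed auto
  ultimately have "g = 0"
    by (metis inner_eq_zero_iff inner_ge_zero order_antisym)
  then have "AE x in unit_leb. L2_fun g x = 0"
    using AE_L2_fun_scaleR[of 0 0] by simp
  then show ?thesis
    using g AE_L2_fun_diff[of "L2_compose \<phi> \<sigma>" "c *\<^sub>R \<epsilon>"] AE_L2_fun_compose[OF assms(1), of \<sigma>]
      AE_L2_fun_scaleR[of c \<epsilon>]
    by eventually_elim (simp add: max_def split: if_splits)
qed

section \<open>The local data sets over a fixed stress\<close>

text \<open>The smallest strain that \<open>D_loc\<close> allows at stress \<open>s\<close>.  As \<open>D_loc\<close> is symmetric about the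
  origin, the largest one is \<open>- lower_branch C \<sigma>0 (- s)\<close>.\<close>

definition lower_branch :: "real \<Rightarrow> real \<Rightarrow> real \<Rightarrow> real"
  where "lower_branch C \<sigma>0 s = (if s \<le> \<sigma>0 then (s - \<sigma>0) / C else (s + \<sigma>0) / C)"

text \<open>An increasing sequence of Lipschitz functions with supremum \<open>lower_branch\<close>: the jump of
  height \<open>2 * \<sigma>0 / C\<close> at \<open>\<sigma>0\<close> is replaced by a ramp of slope \<open>n\<close> to the right of \<open>\<sigma>0\<close>.\<close>

definition lipschitz_branch :: "real \<Rightarrow> real \<Rightarrow> nat \<Rightarrow> real \<Rightarrow> real"
  where "lipschitz_branch C \<sigma>0 n s = (s - \<sigma>0) / C + min (2 * \<sigma>0 / C) (max 0 (real n * (s - \<sigma>0)))"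

lemma lower_branch_in_D_loc:
  assumes "C > 0" "\<sigma>0 \<ge> 0"
  shows "(lower_branch C \<sigma>0 s, s) \<in> D_loc C \<sigma>0"
    and "(- lower_branch C \<sigma>0 (- s), s) \<in> D_loc C \<sigma>0"
  using assms by (auto simp: lower_branch_def D_loc_def field_simps)

lemma lower_branch_le_iff:
  assumes "C > 0"
  shows "lower_branch C \<sigma>0 s \<le> e \<longleftrightarrow> (if s \<le> \<sigma>0 then s - \<sigma>0 \<le> C * e else s + \<sigma>0 \<le> C * e)"
    and "e \<le> - lower_branch C \<sigma>0 (- s) \<longleftrightarrow> (if - s \<le> \<sigma>0 then C * e \<le> s + \<sigma>0 else C * e \<le> s - \<sigma>0)"
  using assms by (auto simp: lower_branch_def field_simps)

lemma D_loc_subset_branches: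
  assumes "C > 0" "\<sigma>0 \<ge> 0" "(e, s) \<in> D_loc C \<sigma>0"
  shows "lower_branch C \<sigma>0 s \<le> e" "e \<le> - lower_branch C \<sigma>0 (- s)"
proof -
  consider "e \<le> 0" "s = C * e + \<sigma>0" | "e \<ge> 0" "s = C * e - \<sigma>0"
    using assms(3) by (auto simp: D_loc_def)
  then have "lower_branch C \<sigma>0 s \<le> e \<and> e \<le> - lower_branch C \<sigma>0 (- s)"
  proof cases
    case 1
    then have "C * e \<le> 0" using assms(1) by (simp add: mult_nonneg_nonpos)
    with 1 assms(2) show ?thesis
      unfolding lower_branch_le_iff[OF assms(1)] by auto
  next
    case 2
    then have "C * e \<ge> 0" using assms(1) by simp
    with 2 assms(2) show ?thesis
      unfolding lower_branch_le_iff[OF assms(1)] by auto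
  qed
  then show "lower_branch C \<sigma>0 s \<le> e" "e \<le> - lower_branch C \<sigma>0 (- s)"
    by simp_all
qed

text \<open>The relaxed local set is obtained from \<open>D_loc\<close> by taking convex hulls in the strain, at each
  fixed stress.\<close>

lemma Dbar_loc_iff:
  assumes "C > 0" "\<sigma>0 \<ge> 0"
  shows "(e, s) \<in> Dbar_loc C \<sigma>0 \<longleftrightarrow> lower_branch C \<sigma>0 s \<le> e \<and> e \<le> - lower_branch C \<sigma>0 (- s)"
proof -
  \<comment> \<open>In terms of \<open>t\<close> both sides are Boolean combinations of linear inequalities.\<close>
  define t where "t = C * e"
  have e: "e = t / C" using assms by (simp add: t_def)
  have cmp: "t / C \<le> - 2 * \<sigma>0 / C \<longleftrightarrow> t \<le> - 2 * \<sigma>0" "- 2 * \<sigma>0 / C \<le> t / C \<longleftrightarrow> - 2 * \<sigma>0 \<le> t"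
    "t / C \<le> 2 * \<sigma>0 / C \<longleftrightarrow> t \<le> 2 * \<sigma>0" "2 * \<sigma>0 / C \<le> t / C \<longleftrightarrow> 2 * \<sigma>0 \<le> t"
    "t / C \<le> 0 \<longleftrightarrow> t \<le> 0" "0 \<le> t / C \<longleftrightarrow> 0 \<le> t"
    using assms(1) by (auto simp: field_simps)
  have "(e, s) \<in> Dbar_loc C \<sigma>0 \<longleftrightarrow>
    (e \<le> - 2 * \<sigma>0 / C \<and> s = t + \<sigma>0) \<or> (- 2 * \<sigma>0 / C \<le> e \<and> e \<le> 0 \<and> - \<sigma>0 \<le> s \<and> s \<le> t + \<sigma>0) \<or>
    (0 \<le> e \<and> e \<le> 2 * \<sigma>0 / C \<and> t - \<sigma>0 \<le> s \<and> s \<le> \<sigma>0) \<or> (2 * \<sigma>0 / C \<le> e \<and> s = t - \<sigma>0)"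
    by (auto simp: Dbar_loc_def t_def)
  also have "\<dots> \<longleftrightarrow>
    (t \<le> - 2 * \<sigma>0 \<and> s = t + \<sigma>0) \<or> (- 2 * \<sigma>0 \<le> t \<and> t \<le> 0 \<and> - \<sigma>0 \<le> s \<and> s \<le> t + \<sigma>0) \<or>
    (0 \<le> t \<and> t \<le> 2 * \<sigma>0 \<and> t - \<sigma>0 \<le> s \<and> s \<le> \<sigma>0) \<or> (2 * \<sigma>0 \<le> t \<and> s = t - \<sigma>0)"
    unfolding e cmp ..
  also have "\<dots> \<longleftrightarrow> (if s \<le> \<sigma>0 then s - \<sigma>0 \<le> t else s + \<sigma>0 \<le> t) \<and>
    (if - s \<le> \<sigma>0 then t \<le> s + \<sigma>0 else t \<le> s - \<sigma>0)"
    using assms(2) by (smt (verit))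
  also have "\<dots> \<longleftrightarrow> lower_branch C \<sigma>0 s \<le> e \<and> e \<le> - lower_branch C \<sigma>0 (- s)"
    by (simp add: lower_branch_le_iff[OF assms(1)] t_def)
  finally show ?thesis .
qed

lemma lipschitz_branch_le:
  assumes "C > 0" "\<sigma>0 \<ge> 0"
  shows "lipschitz_branch C \<sigma>0 n s \<le> lower_branch C \<sigma>0 s"
proof (cases "s \<le> \<sigma>0")
  case True
  then have "real n * (s - \<sigma>0) \<le> 0" by (simp add: mult_nonneg_nonpos)
  with True show ?thesis by (simp add: lipschitz_branch_def lower_branch_def max_def)
next
  case False
  have "lipschitz_branch C \<sigma>0 n s \<le> (s - \<sigma>0) / C + 2 * \<sigma>0 / C"
    unfolding lipschitz_branch_def by (intro add_left_mono) simp
  also have "\<dots> = (s + \<sigma>0) / C" by (simp add: add_divide_distrib[symmetric])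
  finally show ?thesis using False by (simp add: lower_branch_def)
qed

lemma lower_branch_le_if:
  assumes "C > 0" "\<sigma>0 \<ge> 0" "\<And>n. lipschitz_branch C \<sigma>0 n s \<le> e"
  shows "lower_branch C \<sigma>0 s \<le> e"
proof (cases "s \<le> \<sigma>0")
  case True
  have "(s - \<sigma>0) / C \<le> lipschitz_branch C \<sigma>0 0 s"
    using assms by (simp add: lipschitz_branch_def)
  with True assms(3)[of 0] show ?thesis by (simp add: lower_branch_def)
next
  case False
  obtain n where "2 * \<sigma>0 / C < real n * (s - \<sigma>0)"
    using False reals_Archimedean3[of "s - \<sigma>0"] by auto
  then have "lipschitz_branch C \<sigma>0 n s = (s - \<sigma>0) / C + 2 * \<sigma>0 / C"
    using False by (simp add: lipschitz_branch_def)
  also have "\<dots> = (s + \<sigma>0) / C" by (simp add: add_divide_distrib[symmetric])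
  finally show ?thesis using False assms(3)[of n] by (simp add: lower_branch_def)
qed

lemma lipschitz_on_lipschitz_branch:
  assumes "C > 0"
  shows "(1 / C + real n)-lipschitz_on UNIV (lipschitz_branch C \<sigma>0 n)"
proof (rule lipschitz_onI)
  show "0 \<le> 1 / C + real n" using assms by simp
  fix s t :: real
  have "\<bar>min a (max 0 p) - min a (max 0 q)\<bar> \<le> \<bar>p - q\<bar>" for a p q :: real
    by linarith
  then have "\<bar>min (2 * \<sigma>0 / C) (max 0 (real n * (s - \<sigma>0))) - min (2 * \<sigma>0 / C) (max 0 (real n * (t - \<sigma>0)))\<bar>
    \<le> \<bar>real n * (s - \<sigma>0) - real n * (t - \<sigma>0)\<bar>" .
  also have "\<dots> = real n * \<bar>s - t\<bar>"
    by (simp add: abs_mult right_diff_distrib[symmetric])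
  finally have 1: "\<bar>min (2 * \<sigma>0 / C) (max 0 (real n * (s - \<sigma>0))) - min (2 * \<sigma>0 / C) (max 0 (real n * (t - \<sigma>0)))\<bar>
    \<le> real n * \<bar>s - t\<bar>" .
  have 2: "\<bar>(s - \<sigma>0) / C - (t - \<sigma>0) / C\<bar> = 1 / C * \<bar>s - t\<bar>"
    using assms by (simp add: diff_divide_distrib[symmetric])
  have "dist (lipschitz_branch C \<sigma>0 n s) (lipschitz_branch C \<sigma>0 n t)
      \<le> 1 / C * \<bar>s - t\<bar> + real n * \<bar>s - t\<bar>"
    unfolding lipschitz_branch_def dist_real_def 2[symmetric] add_diff_add
    using 1 by (intro order_trans[OF abs_triangle_ineq] add_left_mono)
  then show "dist (lipschitz_branch C \<sigma>0 n s) (lipschitz_branch C \<sigma>0 n t) \<le> (1 / C + real n) * dist s t"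
    by (simp only: dist_real_def distrib_right)
qed

lemma lipschitz_on_reflect:
  assumes "L-lipschitz_on UNIV (\<phi> :: real \<Rightarrow> real)"
  shows "L-lipschitz_on UNIV (\<lambda>s. \<phi> (- s))"
proof (rule lipschitz_onI)
  show "0 \<le> L" using assms by (rule lipschitz_on_nonneg)
  fix s t :: real
  show "dist (\<phi> (- s)) (\<phi> (- t)) \<le> L * dist s t"
    using lipschitz_onD[OF assms, of "- s" "- t"] by (simp add: dist_minus)
qed

text \<open>Membership in \<open>Dbar_loc\<close> amounts to countably many Lipschitz constraints, so the exceptional
  null sets can be united.\<close>

lemma closure_of_data_set_subset:
  assumes "C > 0" "\<sigma>0 \<ge> 0"
  shows "data_topology closure_of (data_set C \<sigma>0 \<times> equilibrium_set eps_bar)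
    \<subseteq> relaxed_data_set C \<sigma>0 \<times> equilibrium_set eps_bar"
proof safe
  fix \<epsilon> \<sigma> \<epsilon>' \<sigma>'
  assume cl: "((\<epsilon>, \<sigma>), (\<epsilon>', \<sigma>')) \<in> data_topology closure_of (data_set C \<sigma>0 \<times> equilibrium_set eps_bar)"
  then show "(\<epsilon>', \<sigma>') \<in> equilibrium_set eps_bar" by (rule closure_of_equilibrium)
  let ?L = "lipschitz_branch C \<sigma>0"
  have "AE x in unit_leb. ?L n (L2_fun \<sigma> x) \<le> 1 * L2_fun \<epsilon> x" for n
  proof (rule closure_of_lipschitz_constraint[where c = 1 and K = "D_loc C \<sigma>0"])
    show "(1 / C + real n)-lipschitz_on UNIV (?L n)"
      using assms(1) by (rule lipschitz_on_lipschitz_branch)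
    show "((\<epsilon>, \<sigma>), (\<epsilon>', \<sigma>')) \<in> data_topology closure_of (pointwise_in (D_loc C \<sigma>0) \<times> equilibrium_set eps_bar)"
      using cl by (simp only: data_set_def)
    show "?L n s \<le> 1 * e" if "(e, s) \<in> D_loc C \<sigma>0" for e s
      using lipschitz_branch_le[OF assms, of n s] D_loc_subset_branches[OF assms that] by simp
  qed
  moreover have "AE x in unit_leb. ?L n (- L2_fun \<sigma> x) \<le> - 1 * L2_fun \<epsilon> x" for n
  proof (rule closure_of_lipschitz_constraint[where \<phi> = "\<lambda>s. ?L n (- s)" and c = "- 1" and K = "D_loc C \<sigma>0"])
    show "(1 / C + real n)-lipschitz_on UNIV (\<lambda>s. ?L n (- s))"
      using assms(1) by (intro lipschitz_on_reflect lipschitz_on_lipschitz_branch)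
    show "((\<epsilon>, \<sigma>), (\<epsilon>', \<sigma>')) \<in> data_topology closure_of (pointwise_in (D_loc C \<sigma>0) \<times> equilibrium_set eps_bar)"
      using cl by (simp only: data_set_def)
    show "?L n (- s) \<le> - 1 * e" if "(e, s) \<in> D_loc C \<sigma>0" for e s
      using lipschitz_branch_le[OF assms, of n "- s"] D_loc_subset_branches[OF assms that] by simp
  qed
  ultimately have "AE x in unit_leb. (\<forall>n. ?L n (L2_fun \<sigma> x) \<le> 1 * L2_fun \<epsilon> x) \<and>
      (\<forall>n. ?L n (- L2_fun \<sigma> x) \<le> - 1 * L2_fun \<epsilon> x)"
    unfolding AE_conj_iff AE_all_countable by blast
  then have "AE x in unit_leb. (L2_fun \<epsilon> x, L2_fun \<sigma> x) \<in> Dbar_loc C \<sigma>0"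
  proof eventually_elim
    case (elim x)
    then show ?case
      using lower_branch_le_if[OF assms, of "L2_fun \<sigma> x" "L2_fun \<epsilon> x"]
        lower_branch_le_if[OF assms, of "- L2_fun \<sigma> x" "- L2_fun \<epsilon> x"]
      by (simp add: Dbar_loc_iff[OF assms])
  qed
  then show "(\<epsilon>, \<sigma>) \<in> relaxed_data_set C \<sigma>0"
    by (simp add: relaxed_data_set_def pointwise_in_def)
qed

section \<open>Replacing a density by an indicator function\<close>

text \<open>Cutting \<open>A\<close> with the half-line \<open>{..t}\<close> gives a measure that depends continuously on \<open>t\<close>, so the
  intermediate value theorem applies.\<close>

lemma subset_of_prescribed_measure:
  assumes A: "A \<in> sets unit_leb" and c: "0 \<le> c" "c \<le> measure unit_leb A"
  shows "\<exists>B\<in>sets unit_leb. B \<subseteq> A \<and> measure unit_leb B = c"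
proof -
  have A': "A \<in> sets lebesgue" "A \<subseteq> {0<..<1}"
    using A by (auto simp: sets_restrict_space_iff)
  have A_lm: "A \<in> lmeasurable"
    using A' by (intro bounded_set_imp_lmeasurable bounded_subset[OF bounded_closed_interval[of 0 1]]) auto
  define g where "g t = measure lebesgue (A \<inter> {..t})" for t
  have lm: "A \<inter> {..t} \<in> lmeasurable" for t
    using A_lm by (rule fmeasurable_Int_fmeasurable) simp
  have mono: "g s \<le> g t" if "s \<le> t" for s t
    unfolding g_def using that lm by (intro measure_mono_fmeasurable) auto
  have lip: "g t \<le> g s + (t - s)" if "s \<le> t" for s t
  proof -
    have "g t \<le> measure lebesgue ((A \<inter> {..s}) \<union> {s..t})"
      unfolding g_def using lm by (intro measure_mono_fmeasurable) (auto intro: fmeasurable.Un)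
    also have "\<dots> \<le> measure lebesgue (A \<inter> {..s}) + measure lebesgue {s..t}"
      using lm by (intro measure_Un_le) auto
    finally show ?thesis using that by (simp add: g_def)
  qed
  have "1-lipschitz_on {0..1} g"
  proof (rule lipschitz_onI)
    fix s t :: real
    show "dist (g s) (g t) \<le> 1 * dist s t"
      using mono[of s t] mono[of t s] lip[of s t] lip[of t s] by (auto simp: dist_real_def abs_if)
  qed simp
  then have "continuous_on {0..1} g" by (rule lipschitz_on_continuous_on)
  moreover have "g 0 = 0" "g 1 = measure unit_leb A"
  proof -
    have "A \<inter> {..0} = {}" "A \<inter> {..1} = A" using A'(2) by auto
    moreover have "measure unit_leb A = measure lebesgue A"
      by (rule measure_restrict_space) (use A'(2) in auto)
    ultimately show "g 0 = 0" "g 1 = measure unit_leb A" by (simp_all add: g_def)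
  qed
  ultimately obtain t where t: "g t = c"
    using IVT'[of g 0 c 1] c by auto
  have "measure unit_leb (A \<inter> {..t}) = measure lebesgue (A \<inter> {..t})"
    by (rule measure_restrict_space) (use A'(2) in auto)
  then have "measure unit_leb (A \<inter> {..t}) = c"
    using t by (simp only: g_def)
  moreover have "A \<inter> {..t} \<in> sets unit_leb"
    using A' by (auto simp: sets_restrict_space_iff)
  ultimately show ?thesis
    by (intro bexI[of _ "A \<inter> {..t}"] conjI Int_lower1)
qed

lemma integrable_simple_approx:
  fixes f :: "'a \<Rightarrow> real"
  assumes f: "integrable M f" and "finite_measure M" and "\<delta> > 0"
  shows "\<exists>s. simple_function M s \<and> (\<integral>x. \<bar>f x - s x\<bar> \<partial>M) < \<delta>"
proof -
  have [measurable]: "f \<in> borel_measurable M" using f by simp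
  obtain s where s: "\<forall>i. simple_function M (s i)" "\<forall>x\<in>space M. (\<lambda>i. s i x) \<longlonglongrightarrow> f x"
    "\<forall>i. \<forall>x\<in>space M. dist (s i x) 0 \<le> 2 * dist (f x) 0"
    using borel_measurable_implies_sequence_metric[OF \<open>f \<in> borel_measurable M\<close>, of 0]
    by (elim exE conjE) (rule that)
  have [measurable]: "s i \<in> borel_measurable M" for i
    using s(1) by (intro borel_measurable_simple_function) simp
  have "(\<lambda>i. \<integral>x. \<bar>f x - s i x\<bar> \<partial>M) \<longlonglongrightarrow> (\<integral>x. 0 \<partial>M)"
  proof (rule integral_dominated_convergence)
    show "integrable M (\<lambda>x. 3 * \<bar>f x\<bar>)" using f by simp
    show "AE x in M. (\<lambda>i. \<bar>f x - s i x\<bar>) \<longlonglongrightarrow> 0"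
    proof (rule AE_I2)
      fix x assume "x \<in> space M"
      from tendsto_rabs[OF tendsto_diff[OF tendsto_const s(2)[rule_format, OF this]], of "f x"]
      show "(\<lambda>i. \<bar>f x - s i x\<bar>) \<longlonglongrightarrow> 0" by simp
    qed
    show "AE x in M. norm \<bar>f x - s i x\<bar> \<le> 3 * \<bar>f x\<bar>" for i
    proof (rule AE_I2)
      fix x assume "x \<in> space M"
      from s(3)[rule_format, OF this, of i] abs_triangle_ineq4[of "f x" "s i x"] show "norm \<bar>f x - s i x\<bar> \<le> 3 * \<bar>f x\<bar>"
        unfolding dist_real_def real_norm_def abs_idempotent diff_zero by linarith
    qed
  qed auto
  then have "eventually (\<lambda>i. (\<integral>x. \<bar>f x - s i x\<bar> \<partial>M) < \<delta>) sequentially"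
    using \<open>\<delta> > 0\<close> by (intro order_tendstoD(2)[where y = 0]) auto
  then obtain i where "(\<integral>x. \<bar>f x - s i x\<bar> \<partial>M) < \<delta>"
    by (auto simp: eventually_sequentially)
  with s(1) show ?thesis by blast
qed

text \<open>Indicator functions are weakly dense among functions with values in \<open>[0, 1]\<close>.  Approximate each
  test function by a simple one and partition the interval into the common level sets of these
  finitely many functions.  If \<open>B\<close> fills each cell \<open>A\<close> up to the measure \<open>\<integral>\<^sub>A \<theta>\<close>, then the
  simple functions do not distinguish \<open>indicator B\<close> from \<open>\<theta>\<close> at all.\<close>

lemma indicator_approximates_density:
  fixes \<theta> :: "real \<Rightarrow> real"
  assumes \<theta> [measurable]: "\<theta> \<in> borel_measurable unit_leb" and \<theta>01: "\<And>x. 0 \<le> \<theta> x" "\<And>x. \<theta> x \<le> 1"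
    and \<Psi>: "finite \<Psi>" "\<And>\<psi>. \<psi> \<in> \<Psi> \<Longrightarrow> integrable unit_leb \<psi>" and "\<delta> > 0"
  shows "\<exists>B\<in>sets unit_leb. \<forall>\<psi>\<in>\<Psi>. \<bar>\<integral>x. (indicator B x - \<theta> x) * \<psi> x \<partial>unit_leb\<bar> < \<delta>"
proof -
  interpret finite_measure unit_leb by (rule finite_measure_unit_leb)
  have "\<forall>\<psi>\<in>\<Psi>. \<exists>s. simple_function unit_leb s \<and> (\<integral>x. \<bar>\<psi> x - s x\<bar> \<partial>unit_leb) < \<delta>"
    using integrable_simple_approx[OF \<Psi>(2) finite_measure_unit_leb \<open>\<delta> > 0\<close>] by blast
  then obtain s where s: "\<And>\<psi>. \<psi> \<in> \<Psi> \<Longrightarrow> simple_function unit_leb (s \<psi>)"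
    "\<And>\<psi>. \<psi> \<in> \<Psi> \<Longrightarrow> (\<integral>x. \<bar>\<psi> x - s \<psi> x\<bar> \<partial>unit_leb) < \<delta>"
    by metis
  \<comment> \<open>The label of a point lists the values of all simple functions there; its level sets are the cells.\<close>
  define l where "l x = (\<lambda>\<psi>\<in>\<Psi>. s \<psi> x)" for x
  define R where "R = l ` space unit_leb"
  have "R \<subseteq> (\<Pi>\<^sub>E \<psi>\<in>\<Psi>. s \<psi> ` space unit_leb)"
    by (auto simp: R_def l_def)
  moreover have "finite (\<Pi>\<^sub>E \<psi>\<in>\<Psi>. s \<psi> ` space unit_leb)"
    using \<Psi>(1) simple_functionD(1)[OF s(1)] by (intro finite_PiE)
  ultimately have finR: "finite R" by (rule finite_subset)
  define A where "A k = {x \<in> space unit_leb. l x = k}" for k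
  have A: "A k \<in> sets unit_leb" if "k \<in> R" for k
  proof -
    have "l x = k \<longleftrightarrow> (\<forall>\<psi>\<in>\<Psi>. s \<psi> x = k \<psi>)" for x
      using that by (auto simp: R_def l_def fun_eq_iff)
    then have "A k = {x \<in> space unit_leb. \<forall>\<psi>\<in>\<Psi>. s \<psi> x = k \<psi>}"
      by (simp add: A_def)
    also have "\<dots> \<in> sets unit_leb"
    proof (rule sets.sets_Collect_finite_All[OF _ \<Psi>(1)])
      fix \<psi> assume "\<psi> \<in> \<Psi>"
      have "{x \<in> space unit_leb. s \<psi> x = k \<psi>} = s \<psi> -` {k \<psi>} \<inter> space unit_leb" by auto
      then show "{x \<in> space unit_leb. s \<psi> x = k \<psi>} \<in> sets unit_leb"
        using simple_functionD(2)[OF s(1)[OF \<open>\<psi> \<in> \<Psi>\<close>]] by simp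
    qed
    finally show ?thesis .
  qed
  have int\<theta>: "integrable unit_leb (\<lambda>x. indicator (A k) x * \<theta> x)" if "k \<in> R" for k
  proof (rule integrable_const_bound[where B = 1])
    show "AE x in unit_leb. norm (indicator (A k) x * \<theta> x) \<le> 1"
      using \<theta>01 by (simp add: indicator_def)
    show "(\<lambda>x. indicator (A k) x * \<theta> x) \<in> borel_measurable unit_leb"
      using A[OF that] by measurable
  qed
  have "\<forall>k\<in>R. \<exists>B\<in>sets unit_leb. B \<subseteq> A k \<and>
      measure unit_leb B = (\<integral>x. indicator (A k) x * \<theta> x \<partial>unit_leb)"
  proof
    fix k assume k: "k \<in> R"
    have "(\<integral>x. indicator (A k) x * \<theta> x \<partial>unit_leb) \<le> (\<integral>x. indicator (A k) x \<partial>unit_leb)"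
    proof (rule integral_mono[OF int\<theta>[OF k]])
      show "integrable unit_leb (indicator (A k) :: real \<Rightarrow> real)"
        using A[OF k] by (simp add: emeasure_eq_measure)
    qed (use \<theta>01 in \<open>simp add: indicator_def\<close>)
    moreover have "0 \<le> (\<integral>x. indicator (A k) x * \<theta> x \<partial>unit_leb)"
      using \<theta>01 by (intro integral_nonneg_AE) simp
    moreover have "A k \<inter> {0<..<1} = A k" by (auto simp: A_def)
    then have "(\<integral>x. indicator (A k) x \<partial>unit_leb) = measure unit_leb (A k)"
      by simp
    ultimately show "\<exists>B\<in>sets unit_leb. B \<subseteq> A k \<and>
      measure unit_leb B = (\<integral>x. indicator (A k) x * \<theta> x \<partial>unit_leb)"
      using subset_of_prescribed_measure[OF A[OF k]] by (simp only:)
  qed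
  then obtain b where b: "\<And>k. k \<in> R \<Longrightarrow> b k \<in> sets unit_leb" "\<And>k. k \<in> R \<Longrightarrow> b k \<subseteq> A k"
    "\<And>k. k \<in> R \<Longrightarrow> measure unit_leb (b k) = (\<integral>x. indicator (A k) x * \<theta> x \<partial>unit_leb)"
    by metis
  have intb: "integrable unit_leb (indicator (b k) :: real \<Rightarrow> real)" if "k \<in> R" for k
    using b(1)[OF that] by (simp add: emeasure_eq_measure)
  define B where "B = (\<Union>k\<in>R. b k)"
  have B [measurable]: "B \<in> sets unit_leb"
    unfolding B_def using finR b(1) by blast
  have "\<bar>\<integral>x. (indicator B x - \<theta> x) * \<psi> x \<partial>unit_leb\<bar> < \<delta>" if \<psi>: "\<psi> \<in> \<Psi>" for \<psi>
  proof -
    have [measurable]: "s \<psi> \<in> borel_measurable unit_leb"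
      using s(1)[OF \<psi>] by (rule borel_measurable_simple_function)
    have int\<psi>: "integrable unit_leb \<psi>" using \<psi> by (rule \<Psi>(2))
    have [measurable]: "\<psi> \<in> borel_measurable unit_leb" using int\<psi> by simp
    have bound: "\<bar>indicator B x - \<theta> x\<bar> \<le> 1" for x
      using \<theta>01[of x] by (auto simp: indicator_def)
    have ints: "integrable unit_leb (s \<psi>)"
    proof -
      have "finite (abs ` s \<psi> ` space unit_leb)"
        using simple_functionD(1)[OF s(1)[OF \<psi>]] by (rule finite_imageI)
      then have "finite ((\<lambda>x. \<bar>s \<psi> x\<bar>) ` space unit_leb)" by (simp only: image_image)
      then have "\<bar>s \<psi> x\<bar> \<le> Max ((\<lambda>x. \<bar>s \<psi> x\<bar>) ` space unit_leb)" if "x \<in> space unit_leb" for x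
        using that by (intro Max_ge) auto
      then show ?thesis
        by (intro integrable_const_bound[where B = "Max ((\<lambda>x. \<bar>s \<psi> x\<bar>) ` space unit_leb)"] AE_I2)
          (simp_all only: real_norm_def \<open>s \<psi> \<in> borel_measurable unit_leb\<close>)
    qed
    have mult: "integrable unit_leb (\<lambda>x. (indicator B x - \<theta> x) * h x)" if h: "integrable unit_leb h" for h
    proof (rule Bochner_Integration.integrable_bound[OF h])
      show "(\<lambda>x. (indicator B x - \<theta> x) * h x) \<in> borel_measurable unit_leb"
        using h by measurable
      have "\<bar>indicator B x - \<theta> x\<bar> * \<bar>h x\<bar> \<le> \<bar>h x\<bar>" for x
        using bound[of x] by (intro mult_left_le_one_le) simp_all
      then show "AE x in unit_leb. norm ((indicator B x - \<theta> x) * h x) \<le> norm (h x)"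
        by (simp only: real_norm_def abs_mult AE_I2)
    qed
    \<comment> \<open>At each point only the cell that contains it contributes to the sum.\<close>
    have "(\<integral>x. (indicator B x - \<theta> x) * s \<psi> x \<partial>unit_leb) =
      (\<integral>x. (\<Sum>k\<in>R. (indicator (b k) x - indicator (A k) x * \<theta> x) * k \<psi>) \<partial>unit_leb)"
    proof (rule Bochner_Integration.integral_cong)
      fix x assume x: "x \<in> space unit_leb"
      then have lR: "l x \<in> R" by (simp add: R_def)
      have "x \<notin> A k" if "k \<noteq> l x" for k using that by (simp add: A_def)
      then have off: "indicator (b k) x - indicator (A k) x * \<theta> x = 0" if "k \<noteq> l x" "k \<in> R" for k
        using that b(2)[of k] by (auto simp: indicator_def)
      have "x \<in> B \<longleftrightarrow> x \<in> b (l x)"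
        using b(2) lR by (auto simp: B_def A_def)
      then have "(indicator B x - \<theta> x) * s \<psi> x =
          (indicator (b (l x)) x - indicator (A (l x)) x * \<theta> x) * l x \<psi>"
        using x \<psi> by (simp add: indicator_def A_def l_def)
      also have "\<dots> = (\<Sum>k\<in>{l x}. (indicator (b k) x - indicator (A k) x * \<theta> x) * k \<psi>)"
        by simp
      also have "\<dots> = (\<Sum>k\<in>R. (indicator (b k) x - indicator (A k) x * \<theta> x) * k \<psi>)"
        using lR finR off by (intro sum.mono_neutral_left) auto
      finally show "(indicator B x - \<theta> x) * s \<psi> x =
        (\<Sum>k\<in>R. (indicator (b k) x - indicator (A k) x * \<theta> x) * k \<psi>)" .
    qed simp
    also have "\<dots> = (\<Sum>k\<in>R. (\<integral>x. (indicator (b k) x - indicator (A k) x * \<theta> x) * k \<psi> \<partial>unit_leb))"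
      by (intro Bochner_Integration.integral_sum integrable_mult_left Bochner_Integration.integrable_diff intb int\<theta>)
    also have "\<dots> = (\<Sum>k\<in>R. 0)"
    proof (rule sum.cong)
      fix k assume k: "k \<in> R"
      have "(\<integral>x. indicator (b k) x - indicator (A k) x * \<theta> x \<partial>unit_leb) = 0"
      proof -
        have "b k \<inter> {0<..<1} = b k" using b(2)[OF k] by (auto simp: A_def)
        then have "(\<integral>x. indicator (b k) x \<partial>unit_leb) = measure unit_leb (b k)" by simp
        then show ?thesis
          using b(3)[OF k] Bochner_Integration.integral_diff[OF intb[OF k] int\<theta>[OF k]] by simp
      qed
      then show "(\<integral>x. (indicator (b k) x - indicator (A k) x * \<theta> x) * k \<psi> \<partial>unit_leb) = 0"
        by simp
    qed simp
    finally have zero: "(\<integral>x. (indicator B x - \<theta> x) * s \<psi> x \<partial>unit_leb) = 0" by simp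
    have "(\<integral>x. (indicator B x - \<theta> x) * \<psi> x \<partial>unit_leb)
        = (\<integral>x. (indicator B x - \<theta> x) * \<psi> x - (indicator B x - \<theta> x) * s \<psi> x \<partial>unit_leb)"
      by (subst Bochner_Integration.integral_diff) (simp_all only: mult[OF int\<psi>] mult[OF ints] zero diff_zero)
    then have "\<bar>\<integral>x. (indicator B x - \<theta> x) * \<psi> x \<partial>unit_leb\<bar>
        \<le> (\<integral>x. \<bar>(indicator B x - \<theta> x) * \<psi> x - (indicator B x - \<theta> x) * s \<psi> x\<bar> \<partial>unit_leb)"
      by (simp only: integral_abs_bound)
    also have "\<dots> \<le> (\<integral>x. \<bar>\<psi> x - s \<psi> x\<bar> \<partial>unit_leb)"
    proof (rule integral_mono)
      fix x
      have "\<bar>(indicator B x - \<theta> x) * (\<psi> x - s \<psi> x)\<bar> \<le> \<bar>\<psi> x - s \<psi> x\<bar>"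
        unfolding abs_mult using bound[of x] by (intro mult_left_le_one_le) simp_all
      then show "\<bar>(indicator B x - \<theta> x) * \<psi> x - (indicator B x - \<theta> x) * s \<psi> x\<bar> \<le> \<bar>\<psi> x - s \<psi> x\<bar>"
        by (simp only: right_diff_distrib)
    qed (intro integrable_abs Bochner_Integration.integrable_diff mult int\<psi> ints)+
    also have "\<dots> < \<delta>" using \<psi> by (rule s(2))
    finally show ?thesis .
  qed
  with B show ?thesis by blast
qed

section \<open>Weak approximation of relaxed states\<close>

lemma lower_le_upper_branch:
  assumes "C > 0" "\<sigma>0 \<ge> 0"
  shows "lower_branch C \<sigma>0 s \<le> - lower_branch C \<sigma>0 (- s)"
  using D_loc_subset_branches(2)[OF assms lower_branch_in_D_loc(1)[OF assms]] .

lemma branch_gap_le: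
  assumes "C > 0" "\<sigma>0 \<ge> 0"
  shows "- lower_branch C \<sigma>0 (- s) - lower_branch C \<sigma>0 s \<le> 2 * \<sigma>0 / C"
  using assms by (auto simp: lower_branch_def field_simps)

lemma sq_integrable_lower_branch:
  assumes "C > 0" "\<sigma>0 \<ge> 0" and f: "sq_integrable f"
  shows "sq_integrable (\<lambda>x. lower_branch C \<sigma>0 (f x))"
proof (rule sq_integrable_mono)
  show "sq_integrable (\<lambda>x. \<sigma>0 / C + 1 / C * \<bar>f x\<bar>)"
    by (intro sq_integrable_add sq_integrable_const sq_integrable_scale sq_integrable_abs f)
  have [measurable]: "lower_branch C \<sigma>0 \<in> borel_measurable borel"
    unfolding lower_branch_def by measurable
  have [measurable]: "f \<in> borel_measurable unit_leb"
    using f by (simp add: sq_integrable_def)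
  show "(\<lambda>x. lower_branch C \<sigma>0 (f x)) \<in> borel_measurable unit_leb" by measurable
  fix x
  have "\<bar>lower_branch C \<sigma>0 (f x)\<bar> \<le> (\<bar>f x\<bar> + \<sigma>0) / C"
    using assms by (auto simp: lower_branch_def abs_divide intro!: divide_right_mono)
  also have "\<dots> = \<sigma>0 / C + 1 / C * \<bar>f x\<bar>" by (simp add: add_divide_distrib)
  finally show "\<bar>lower_branch C \<sigma>0 (f x)\<bar> \<le> \<bar>\<sigma>0 / C + 1 / C * \<bar>f x\<bar>\<bar>" by linarith
qed

text \<open>Write \<open>\<epsilon> = lo + \<theta> (hi - lo)\<close> with the two admissible strains \<open>lo\<close>, \<open>hi\<close> at the stress \<open>\<sigma>\<close> and
  a density \<open>\<theta>\<close>, and replace \<open>\<theta>\<close> by an indicator function.  The jump \<open>hi - lo\<close> is at most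
  \<open>2 * \<sigma>0 / C\<close>, so the change of \<open>\<epsilon>\<close> is bounded in norm independently of the functionals, which
  permits replacing these by nearby inner products.\<close>

lemma relaxed_data_weakly_approximable:
  assumes "C > 0" "\<sigma>0 \<ge> 0" and mem: "(\<epsilon>, \<sigma>) \<in> relaxed_data_set C \<sigma>0"
    and G: "finite G" "\<And>g. g \<in> G \<Longrightarrow> bounded_linear (g :: L2 \<Rightarrow> real)" and "\<delta> > 0"
  shows "\<exists>\<epsilon>'. (\<epsilon>', \<sigma>) \<in> data_set C \<sigma>0 \<and> (\<forall>g\<in>G. \<bar>g (\<epsilon>' - \<epsilon>)\<bar> < \<delta>)"
proof -
  define lo hi where "lo x = lower_branch C \<sigma>0 (L2_fun \<sigma> x)" and "hi x = - lower_branch C \<sigma>0 (- L2_fun \<sigma> x)" for x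
  define M where "M = 2 * \<sigma>0 / C"
  have M: "M \<ge> 0" using assms by (simp add: M_def)
  have neg: "sq_integrable (\<lambda>x. - f x)" if "sq_integrable f" for f
    using sq_integrable_scale[OF that, of "- 1"] by simp
  have lo: "sq_integrable lo"
    unfolding lo_def by (intro sq_integrable_lower_branch assms sq_integrable_L2_fun)
  have hi: "sq_integrable hi"
    unfolding hi_def by (intro neg sq_integrable_lower_branch assms sq_integrable_L2_fun)
  have gap: "sq_integrable (\<lambda>x. hi x - lo x)"
    using sq_integrable_add[OF hi neg[OF lo]] by simp
  have [measurable]: "lo \<in> borel_measurable unit_leb" "hi \<in> borel_measurable unit_leb"
    using lo hi by (simp_all add: sq_integrable_def)
  have lohi: "0 \<le> hi x - lo x" "hi x - lo x \<le> M" for x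
    using lower_le_upper_branch[OF assms(1,2), of "L2_fun \<sigma> x"] branch_gap_le[OF assms(1,2), of "L2_fun \<sigma> x"]
    by (simp_all add: lo_def hi_def M_def)
  \<comment> \<open>Clamping keeps \<open>\<theta>\<close> in \<open>[0, 1]\<close> on the null set where \<open>\<epsilon>\<close> leaves \<open>[lo, hi]\<close>;
    where \<open>lo = hi\<close> the division by zero yields \<open>0\<close>.\<close>
  define \<theta> where "\<theta> x = max 0 (min 1 ((L2_fun \<epsilon> x - lo x) / (hi x - lo x)))" for x
  have \<theta>: "\<theta> \<in> borel_measurable unit_leb" unfolding \<theta>_def by measurable
  have \<theta>01: "0 \<le> \<theta> x" "\<theta> x \<le> 1" for x by (simp_all add: \<theta>_def)
  have mix: "AE x in unit_leb. L2_fun \<epsilon> x = lo x + \<theta> x * (hi x - lo x)"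
  proof -
    have "AE x in unit_leb. (L2_fun \<epsilon> x, L2_fun \<sigma> x) \<in> Dbar_loc C \<sigma>0"
      using mem by (simp add: relaxed_data_set_def pointwise_in_def)
    then show ?thesis
    proof eventually_elim
      case (elim x)
      then have e: "lo x \<le> L2_fun \<epsilon> x" "L2_fun \<epsilon> x \<le> hi x"
        by (simp_all add: Dbar_loc_iff[OF assms(1,2)] lo_def hi_def)
      show ?case
      proof (cases "hi x = lo x")
        case True
        with e show ?thesis by simp
      next
        case False
        with lohi[of x] have "hi x - lo x > 0" by simp
        with e show ?thesis by (simp add: \<theta>_def)
      qed
    qed
  qed
  \<comment> \<open>Half of \<open>\<delta>\<close> pays for passing to inner products, the other half for the choice of \<open>B\<close>.\<close>
  define \<eta> where "\<eta> = \<delta> / (2 * (M + 1))"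
  have \<eta>: "\<eta> > 0" "\<eta> * M < \<delta> / 2"
    using \<open>\<delta> > 0\<close> M by (simp_all add: \<eta>_def field_simps)
  have "\<forall>g\<in>G. \<exists>u. \<forall>w. \<bar>g w - inner u w\<bar> \<le> \<eta> * norm w"
    using bounded_linear_approx_inner[OF G(2) \<eta>(1)] by metis
  then obtain u where u: "\<And>g w. g \<in> G \<Longrightarrow> \<bar>g w - inner (u g) w\<bar> \<le> \<eta> * norm w"
    by metis
  let ?\<Psi> = "(\<lambda>g x. (hi x - lo x) * L2_fun (u g) x) ` G"
  have "\<exists>B\<in>sets unit_leb. \<forall>\<psi>\<in>?\<Psi>. \<bar>\<integral>x. (indicator B x - \<theta> x) * \<psi> x \<partial>unit_leb\<bar> < \<delta> / 2"
  proof (rule indicator_approximates_density[OF \<theta> \<theta>01])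
    show "integrable unit_leb \<psi>" if "\<psi> \<in> ?\<Psi>" for \<psi>
      using that sq_integrable_mult[OF gap sq_integrable_L2_fun] by auto
  qed (use G(1) \<open>\<delta> > 0\<close> in auto)
  then obtain B where B: "B \<in> sets unit_leb"
    and B_small: "\<And>g. g \<in> G \<Longrightarrow>
      \<bar>\<integral>x. (indicator B x - \<theta> x) * ((hi x - lo x) * L2_fun (u g) x) \<partial>unit_leb\<bar> < \<delta> / 2"
    by auto
  define \<epsilon>' where "\<epsilon>' = abs_L2 (\<lambda>x. lo x + indicator B x * (hi x - lo x))"
  have \<epsilon>': "AE x in unit_leb. L2_fun \<epsilon>' x = lo x + indicator B x * (hi x - lo x)"
    unfolding \<epsilon>'_def
  proof (rule AE_L2_fun_abs_L2[OF sq_integrable_add[OF lo sq_integrable_mono[OF gap]]])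
    show "(\<lambda>x. indicator B x * (hi x - lo x)) \<in> borel_measurable unit_leb"
      using B by measurable
  qed (simp add: indicator_def)
  have w: "AE x in unit_leb. L2_fun (\<epsilon>' - \<epsilon>) x = (indicator B x - \<theta> x) * (hi x - lo x)"
    using AE_L2_fun_diff[of \<epsilon>' \<epsilon>] \<epsilon>' mix by eventually_elim (simp add: left_diff_distrib)
  have "norm (\<epsilon>' - \<epsilon>) \<le> norm (M *\<^sub>R L2_one)"
  proof (rule norm_L2_mono)
    show "AE x in unit_leb. \<bar>L2_fun (\<epsilon>' - \<epsilon>) x\<bar> \<le> \<bar>L2_fun (M *\<^sub>R L2_one) x\<bar>"
      using w AE_L2_fun_scaleR[of M L2_one] AE_L2_fun_one
    proof eventually_elim
      case (elim x)
      have "\<bar>indicator B x - \<theta> x\<bar> \<le> 1"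
        using \<theta>01[of x] by (auto simp: indicator_def)
      then have "\<bar>(indicator B x - \<theta> x) * (hi x - lo x)\<bar> \<le> 1 * M"
        unfolding abs_mult using lohi[of x] by (intro mult_mono) auto
      with elim M show ?case by simp
    qed
  qed
  then have norm_w: "norm (\<epsilon>' - \<epsilon>) \<le> M" using M by (simp add: norm_L2_one)
  have "\<bar>g (\<epsilon>' - \<epsilon>)\<bar> < \<delta>" if g: "g \<in> G" for g
  proof -
    have "inner (u g) (\<epsilon>' - \<epsilon>) = (\<integral>x. (indicator B x - \<theta> x) * ((hi x - lo x) * L2_fun (u g) x) \<partial>unit_leb)"
      unfolding inner_L2_eq
    proof (rule integral_cong_AE)
      show "AE x in unit_leb. L2_fun (u g) x * L2_fun (\<epsilon>' - \<epsilon>) x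
          = (indicator B x - \<theta> x) * ((hi x - lo x) * L2_fun (u g) x)"
        using w by eventually_elim (simp only: mult_ac)
      show "(\<lambda>x. (indicator B x - \<theta> x) * ((hi x - lo x) * L2_fun (u g) x)) \<in> borel_measurable unit_leb"
        using B \<theta> by measurable
    qed measurable
    with B_small[OF g] have "\<bar>inner (u g) (\<epsilon>' - \<epsilon>)\<bar> < \<delta> / 2" by simp
    moreover have "\<bar>g (\<epsilon>' - \<epsilon>) - inner (u g) (\<epsilon>' - \<epsilon>)\<bar> \<le> \<eta> * M"
      using u[OF g, of "\<epsilon>' - \<epsilon>"] mult_left_mono[OF norm_w, of \<eta>] \<eta>(1) by linarith
    ultimately show ?thesis using \<eta>(2) by linarith
  qed
  moreover have "(\<epsilon>', \<sigma>) \<in> data_set C \<sigma>0"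
  proof -
    have "AE x in unit_leb. (L2_fun \<epsilon>' x, L2_fun \<sigma> x) \<in> D_loc C \<sigma>0"
      using \<epsilon>'
    proof eventually_elim
      case (elim x)
      then have "L2_fun \<epsilon>' x = lo x \<or> L2_fun \<epsilon>' x = hi x"
        by (auto simp: indicator_def)
      then show ?case
        using lower_branch_in_D_loc[OF assms(1,2), of "L2_fun \<sigma> x"] by (auto simp: lo_def hi_def)
    qed
    then show ?thesis by (simp add: data_set_def pointwise_in_def)
  qed
  ultimately show ?thesis by blast
qed

section \<open>The closure of the data set\<close>

text \<open>Both strains are changed by the same oscillation \<open>w\<close>, except that the equilibrium strain must
  keep its mean and is changed by \<open>P w = w - (\<integral> w)\<close> instead.  The difference of the two components then
  changes by the constant \<open>\<integral> w\<close> only, which is small in norm because the mean is one of the tested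
  functionals.\<close>

lemma relaxed_data_set_subset_closure:
  assumes "C > 0" "\<sigma>0 \<ge> 0"
  shows "relaxed_data_set C \<sigma>0 \<times> equilibrium_set eps_bar
    \<subseteq> data_topology closure_of (data_set C \<sigma>0 \<times> equilibrium_set eps_bar)"
proof safe
  fix \<epsilon> \<sigma> \<tau> \<rho>
  assume y: "(\<epsilon>, \<sigma>) \<in> relaxed_data_set C \<sigma>0" and z: "(\<tau>, \<rho>) \<in> equilibrium_set eps_bar"
  have "\<exists>p. p \<in> data_set C \<sigma>0 \<times> equilibrium_set eps_bar \<and> p \<in> U"
    if U: "((\<epsilon>, \<sigma>), (\<tau>, \<rho>)) \<in> U \<and> openin data_topology U" for U
  proof -
    obtain F \<delta> where F: "finite F" "\<forall>f\<in>F. bounded_linear (f :: Z \<Rightarrow> real)" "\<delta> > (0::real)"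
      and sub: "\<forall>y' z'. (\<forall>f\<in>F. \<bar>f (y' - (\<epsilon>, \<sigma>))\<bar> < \<delta>) \<and> (\<forall>f\<in>F. \<bar>f (z' - (\<tau>, \<rho>))\<bar> < \<delta>) \<and>
        norm ((y' - z') - ((\<epsilon>, \<sigma>) - (\<tau>, \<rho>))) < \<delta> \<longrightarrow> (y', z') \<in> U"
      using openin_data_topology_finite_functionals[OF conjunct2[OF U] conjunct1[OF U]]
      by (elim exE conjE) (rule that)
    define P :: "L2 \<Rightarrow> L2" where "P w = w - inner w L2_one *\<^sub>R L2_one" for w
    have P: "bounded_linear P"
      unfolding P_def by (intro bounded_linear_intros)
    \<comment> \<open>Pulled back to \<open>w\<close>: the functionals of the neighbourhood at the two perturbations \<open>(w, 0)\<close> and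
      \<open>(P w, 0)\<close>, and the mean.\<close>
    define G where "G = (\<lambda>f w. f (w, 0)) ` F \<union> (\<lambda>f w. f (P w, 0)) ` F \<union> {\<lambda>w. inner w L2_one}"
    have inj: "bounded_linear (\<lambda>w :: L2. (w, 0 :: L2))"
      by (intro bounded_linear_Pair bounded_linear_ident bounded_linear_zero)
    have lin: "bounded_linear g" if g: "g \<in> G" for g
    proof -
      consider f where "f \<in> F" "g = (\<lambda>w. f (w, 0))" | f where "f \<in> F" "g = (\<lambda>w. f (P w, 0))"
        | "g = (\<lambda>w. inner w L2_one)"
        using g unfolding G_def by blast
      then show ?thesis
      proof cases
        case 1
        then show ?thesis using F(2) bounded_linear_compose[OF _ inj] by auto
      next
        case 2
        then show ?thesis
          using F(2) bounded_linear_compose[OF _ bounded_linear_compose[OF inj P]] by auto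
      next
        case 3
        then show ?thesis by (simp add: bounded_linear_inner_left)
      qed
    qed
    have "finite G" using F(1) by (simp add: G_def)
    from relaxed_data_weakly_approximable[OF assms y this lin F(3)] obtain \<epsilon>' where data: "(\<epsilon>', \<sigma>) \<in> data_set C \<sigma>0" and small: "\<And>g. g \<in> G \<Longrightarrow> \<bar>g (\<epsilon>' - \<epsilon>)\<bar> < \<delta>" by blast
    define w where "w = \<epsilon>' - \<epsilon>"
    have "inner (P w) L2_one = 0"
      by (simp add: P_def inner_diff_left inner_L2_one_one)
    then have equi: "(\<tau> + P w, \<rho>) \<in> equilibrium_set eps_bar"
      using z by (simp add: equilibrium_set_iff inner_add_left)
    have "((\<epsilon>', \<sigma>), (\<tau> + P w, \<rho>)) \<in> U"
    proof (rule sub[rule_format], intro conjI ballI)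
      show "\<bar>f ((\<epsilon>', \<sigma>) - (\<epsilon>, \<sigma>))\<bar> < \<delta>" if "f \<in> F" for f
        using small[of "\<lambda>w. f (w, 0)"] that by (simp add: G_def)
      show "\<bar>f ((\<tau> + P w, \<rho>) - (\<tau>, \<rho>))\<bar> < \<delta>" if "f \<in> F" for f
        using small[of "\<lambda>w. f (P w, 0)"] that by (simp add: G_def w_def)
      have "((\<epsilon>', \<sigma>) - (\<tau> + P w, \<rho>)) - ((\<epsilon>, \<sigma>) - (\<tau>, \<rho>)) = (inner w L2_one *\<^sub>R L2_one, 0)"
        by (simp add: P_def w_def)
      moreover have "\<bar>inner w L2_one\<bar> < \<delta>"
        using small[of "\<lambda>w. inner w L2_one"] by (simp add: G_def w_def)
      ultimately show "norm (((\<epsilon>', \<sigma>) - (\<tau> + P w, \<rho>)) - ((\<epsilon>, \<sigma>) - (\<tau>, \<rho>))) < \<delta>"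
        by (simp add: norm_Pair norm_L2_one)
    qed
    with data equi show ?thesis by blast
  qed
  then show "((\<epsilon>, \<sigma>), (\<tau>, \<rho>)) \<in> data_topology closure_of (data_set C \<sigma>0 \<times> equilibrium_set eps_bar)"
    by (simp only: in_closure_of topspace_data_topology UNIV_I simp_thms) blast
qed

theorem theorem3p5:
  fixes C \<sigma>0 eps_bar :: real
  assumes "C > 0" and "\<sigma>0 \<ge> 0"
  shows "is_Kuratowski_limit data_topology
    (\<lambda>h. data_set C \<sigma>0 \<times> equilibrium_set eps_bar)
    (relaxed_data_set C \<sigma>0 \<times> equilibrium_set eps_bar)"
proof -
  have "data_topology closure_of (data_set C \<sigma>0 \<times> equilibrium_set eps_bar)
      = relaxed_data_set C \<sigma>0 \<times> equilibrium_set eps_bar"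
    using closure_of_data_set_subset[OF assms] relaxed_data_set_subset_closure[OF assms]
    by (rule subset_antisym)
  then show ?thesis
    using is_Kuratowski_limit_const[of data_topology "data_set C \<sigma>0 \<times> equilibrium_set eps_bar"]
    by (simp only:)
qed

end
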